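(* Let $n\ge1$. For any opener-closer configuration $(\mathcal O,\mathcal C)$ there exist a unique non-crossing set partition $\mathcal B$ of type $B_n$ and a unique non-nesting set partition $\mathcal B'$ of type $B_n$ such that $$\operatorname{op}(\mathcal B)=\operatorname{op}(\mathcal B')=\mathcal O\quad\text{and}\quad \operatorname{cl}(\mathcal B)=\operatorname{cl}(\mathcal B')=\mathcal C.$$
   Context: Let $[n]=\{1,\dots,n\}$ (with $[0]=\emptyset$) and $[\pm n]=\{1,\dots,n,-1,\dots,-n\}$. A set partition of type $B_n$ is a set partition $\mathcal B$ of $[\pm n]$ such that $B\in\mathcal B\Leftrightarrow -B\in\mathcal B$ and such that there is at most one block $B_0\in\mathcal B$ (the zero block) with $B_0=-B_0$. An opener-closer configuration is a pair $(\mathcal O,\mathcal C)$ of subsets $\mathcal O,\mathcal C\subseteq[n]$ with $|\mathcal O\cap[k]|\ge|\mathcal C\cap[k+1]|$ for all $k\in\{0,1,\dots,n-1\}$ (it is not required that $|\mathcal O|=|\mathcal C|$). Crossing diagram: place $[\pm n]$ on a line in the crossing order $1<2<\dots<n<-1<-2<\dots<-n$, and join by an arc any two elements that are consecutive in their block with respect to the order $1<2<\dots<n<-n<\dots<-2<-1$. Such an arc is written $(i,j)$, where $i$ (its opener) precedes $j$ (its closer) in the latter order. Nesting diagram: place $[\pm n]\cup\{0\}$ on a line in the type $B$ nesting order $1<2<\dots<n<0<-n<\dots<-2<-1$; add the element $0$ to the zero block, if there is one; and join by an arc any two elements that are consecutive in their (augmented) block with respect to this order. Such an arc is written $(i,j)$,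 where $i$ (its opener) precedes $j$ (its closer) in this order. A (type $B$) crossing is an unordered pair of arcs of the crossing diagram whose endpoint sets can be written $\{a,b\}$, $\{a',b'\}$ with $a<a'<b<b'$ in the crossing order, except that the pair is not counted if both arcs have positive opener and negative closer and at least one of them has a closer smaller in absolute value than its opener. A (type $B$) nesting is an unordered pair of arcs of the nesting diagram whose endpoint sets can be written $\{a,b\}$, $\{a',b'\}$ with $a<a'<b'<b$ in the type $B$ nesting order, except that the pair is not counted if both arcs have a positive opener or begin at $0$, both have a negative closer or end at $0$, and at least one of them has a closer smaller in absolute value than its opener. Here $0$ is regarded as having larger absolute value than every element of $[\pm n]$: an arc $(i,0)$ with $i>0$ does not have a closer smaller than its opener, whereas an arc $(0,-i)$ does. A set partition of type $B_n$ is non-crossing (non-nesting) if it has no crossings (no nestings) in this sense. The openers $\operatorname{op}(\mathcal B)$ are the positive elements that are not maximal in their block with respect to the nesting order; the closers $\operatorname{cl}(\mathcal B)$ are the positive elements that are not minimal in their block with respect to the nesting order. The number $0$ is neither an opener nor a closer. *)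

theory Defs
  imports Main "HOL-Library.Disjoint_Sets"
begin

definition pm_interval :: "nat \<Rightarrow> int set" where
  "pm_interval n = {i. i \<noteq> 0 \<and> \<bar>i\<bar> \<le> int n}"

definition is_zero_block :: "int set \<Rightarrow> bool" where
  "is_zero_block B \<longleftrightarrow> B = uminus ` B"

definition set_partition_B :: "nat \<Rightarrow> int set set \<Rightarrow> bool" where
  "set_partition_B n P \<longleftrightarrow>
     partition_on (pm_interval n) P \<and>
     (\<forall>B. B \<in> P \<longleftrightarrow> uminus ` B \<in> P) \<and>
     (\<forall>B\<in>P. \<forall>B'\<in>P. is_zero_block B \<longrightarrow> is_zero_block B' \<longrightarrow> B = B')"

definition opener_closer_configuration :: "nat \<Rightarrow> int set \<Rightarrow> int set \<Rightarrow> bool" where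
  "opener_closer_configuration n \<O> \<C> \<longleftrightarrow>
     \<O> \<subseteq> {1..int n} \<and> \<C> \<subseteq> {1..int n} \<and>
     (\<forall>k\<in>{0..<n}. card (\<O> \<inter> {1..int k}) \<ge> card (\<C> \<inter> {1..int k + 1}))"

text \<open>The two orders are defined uniformly in \<open>n\<close>, on all integers:
  the crossing order is \<open>1 < 2 < \<dots> < -1 < -2 < \<dots>\<close> (with \<open>0\<close> incomparable to everything),
  and the nesting order is \<open>1 < 2 < \<dots> < 0 < \<dots> < -2 < -1\<close>.  Restricted to nonzero elements,
  the latter is the order which also determines the arcs of the crossing diagram.\<close>

definition crossing_less :: "int \<Rightarrow> int \<Rightarrow> bool" where
  "crossing_less i j \<longleftrightarrow> (0 < i \<and> j < 0) \<or> (0 < i \<and> i < j) \<or> (j < i \<and> i < 0)"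

definition nesting_less :: "int \<Rightarrow> int \<Rightarrow> bool" where
  "nesting_less i j \<longleftrightarrow>
     (0 < i \<and> j \<le> 0) \<or> (i = 0 \<and> j < 0) \<or> (0 < i \<and> i < j) \<or> (i < j \<and> j < 0)"

text \<open>An arc is a pair (opener, closer).\<close>

definition block_arcs :: "int set \<Rightarrow> (int \<times> int) set" where
  "block_arcs B = {(i, j). i \<in> B \<and> j \<in> B \<and> nesting_less i j \<and>
     \<not> (\<exists>k\<in>B. nesting_less i k \<and> nesting_less k j)}"

definition crossing_arcs :: "int set set \<Rightarrow> (int \<times> int) set" where
  "crossing_arcs P = (\<Union>B\<in>P. block_arcs B)"

definition nesting_arcs :: "int set set \<Rightarrow> (int \<times> int) set" where
  "nesting_arcs P = (\<Union>B\<in>P. block_arcs (if is_zero_block B then insert 0 B else B))"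

definition endpoints :: "int \<times> int \<Rightarrow> int set" where
  "endpoints \<alpha> = {fst \<alpha>, snd \<alpha>}"

text \<open>Comparison of absolute values, where \<open>0\<close> counts as having the largest one.\<close>

definition abs_less :: "int \<Rightarrow> int \<Rightarrow> bool" where
  "abs_less i j \<longleftrightarrow> i \<noteq> 0 \<and> (j = 0 \<or> \<bar>i\<bar> < \<bar>j\<bar>)"

definition closer_smaller :: "int \<times> int \<Rightarrow> bool" where
  "closer_smaller \<alpha> \<longleftrightarrow> abs_less (snd \<alpha>) (fst \<alpha>)"

text \<open>The sets of crossings and of nestings of a set partition, as sets of unordered pairs
  of arcs; the final negated conjunct of each definition excludes the pairs that are not counted.\<close>

definition crossings :: "int set set \<Rightarrow> (int \<times> int) set set" where
  "crossings P = {{\<alpha>, \<beta>} | \<alpha> \<beta>. \<alpha> \<in> crossing_arcs P \<and> \<beta> \<in> crossing_arcs P \<and>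
     (\<exists>a b a' b'. endpoints \<alpha> = {a, b} \<and> endpoints \<beta> = {a', b'} \<and>
        crossing_less a a' \<and> crossing_less a' b \<and> crossing_less b b') \<and>
     \<not> (0 < fst \<alpha> \<and> snd \<alpha> < 0 \<and> 0 < fst \<beta> \<and> snd \<beta> < 0 \<and>
        (closer_smaller \<alpha> \<or> closer_smaller \<beta>))}"

definition nestings :: "int set set \<Rightarrow> (int \<times> int) set set" where
  "nestings P = {{\<alpha>, \<beta>} | \<alpha> \<beta>. \<alpha> \<in> nesting_arcs P \<and> \<beta> \<in> nesting_arcs P \<and>
     (\<exists>a b a' b'. endpoints \<alpha> = {a, b} \<and> endpoints \<beta> = {a', b'} \<and>
        nesting_less a a' \<and> nesting_less a' b' \<and> nesting_less b' b) \<and>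
     \<not> (0 \<le> fst \<alpha> \<and> snd \<alpha> \<le> 0 \<and> 0 \<le> fst \<beta> \<and> snd \<beta> \<le> 0 \<and>
        (closer_smaller \<alpha> \<or> closer_smaller \<beta>))}"

definition non_crossing :: "int set set \<Rightarrow> bool" where
  "non_crossing P \<longleftrightarrow> crossings P = {}"

definition non_nesting :: "int set set \<Rightarrow> bool" where
  "non_nesting P \<longleftrightarrow> nestings P = {}"

definition openers :: "int set set \<Rightarrow> int set" where
  "openers P = {i. 0 < i \<and> (\<exists>B\<in>P. i \<in> B \<and> (\<exists>j\<in>B. nesting_less i j))}"

definition closers :: "int set set \<Rightarrow> int set" where
  "closers P = {i. 0 < i \<and> (\<exists>B\<in>P. i \<in> B \<and> (\<exists>j\<in>B. nesting_less j i))}"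

end

theory Submission
  imports Defs
begin

text \<open>A partition of type \<open>B\<^sub>n\<close> is determined by its arcs, and by the symmetry \<open>i \<mapsto> - i\<close>
already by two pieces of data on the positive elements: the arcs \<open>(i, j)\<close> with \<open>0 < i < j\<close>, which
match every closer with a smaller opener, and the arcs \<open>(i, - j)\<close>, which by symmetry form an involution
on the openers that remain.  A fixed point of this involution is the middle arc \<open>(i, - i)\<close> of the zero
block, so there is at most one.  Conversely, all such data come from a partition
(\<open>partition_of_half_diagram\<close>), because the connected components of the arcs are increasing paths.

Both properties of the theorem split into one condition for each piece of data.  The matching has to be
greedy: reading closers from left to right, each takes the last free opener in the non-crossing
case, and the first free opener in the non-nesting case (\<open>non_crossing_iff_greedy\<close>,
\<open>non_nesting_iff_greedy\<close>).  The inequalities of an opener-closer configuration say that a free opener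
is always available, so that the greedy matching exists; it is clearly unique.

The involution on the remaining openers has to reverse the order.  In the non-crossing case
the reversal is the whole answer, with a fixed point in the middle if the number of these openers is odd.
In the non-nesting case the middle arc is cut at \<open>0\<close>, and \<open>(i, 0)\<close> would be enclosed by the
arc that joins a smaller remaining opener to its partner; so a fixed point must be the smallest remaining opener, and the others are
reversed without fixed point.  The parity of the number of these openers then decides whether there is a fixed
point, and again exactly one involution is left (\<open>ex1_mid_noncrossing\<close>,
\<open>ex1_mid_nonnesting\<close>).\<close>

section \<open>Matching closers greedily with smaller openers\<close>

text \<open>\<open>greedy w X M\<close> says that, in a scan from left to right, every closer \<open>j\<close> takes the opener of largest
weight among those that are still free: a heavier opener \<open>r < j\<close> must have been given to a closer
up to \<open>j\<close>.  With weight \<open>id\<close> this is the last free opener (matching of brackets), with weight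
\<open>uminus\<close> the first free one (a queue).\<close>

definition greedy :: "('a::linorder \<Rightarrow> 'b::linorder) \<Rightarrow> 'a set \<Rightarrow> ('a \<times> 'a) set \<Rightarrow> bool" where
  "greedy w X M \<longleftrightarrow>
     (\<forall>(i, j)\<in>M. \<forall>r\<in>X. w i < w r \<and> r < j \<longrightarrow> (\<exists>j'\<le>j. (r, j') \<in> M))"

definition increasing_matching :: "('a::linorder \<times> 'a) set \<Rightarrow> bool" where
  "increasing_matching M \<longleftrightarrow> single_valued M \<and> single_valued (M\<inverse>) \<and> (\<forall>(i, j)\<in>M. i < j)"

text \<open>At the first closer where two greedy matchings differ, both have used the same openers before, so
each of the two choices would be at least as heavy as the other.\<close>

lemma greedy_matching_unique:
  fixes M N :: "('a::linorder \<times> 'a) set" and w :: "'a \<Rightarrow> 'b::linorder"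
  assumes M: "increasing_matching M" "greedy w X M" "Domain M \<subseteq> X" "Range M = Y"
    and N: "increasing_matching N" "greedy w X N" "Domain N \<subseteq> X" "Range N = Y"
    and Y: "finite Y" and w: "inj w"
  shows "M = N"
proof -
  have step: False
    if K: "increasing_matching K" "greedy w X K"
      and L: "increasing_matching L" "Domain L \<subseteq> X"
      and ih: "\<And>i j'. j' < j \<Longrightarrow> (i, j') \<in> K \<longleftrightarrow> (i, j') \<in> L"
      and ij: "(i, j) \<in> K" "(i', j) \<in> L" "w i < w i'" for K L and i i' j :: 'a
  proof -
    have "i' \<in> X" "i' < j"
      using L ij by (auto simp: increasing_matching_def)
    then obtain j' where j': "j' \<le> j" "(i', j') \<in> K"
      using K(2) ij unfolding greedy_def by blast
    show False
    proof (cases "j' = j")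
      case True
      then have "i' = i"
        using K(1) j' ij unfolding increasing_matching_def single_valued_def by blast
      then show False using ij by simp
    next
      case False
      then have "(i', j') \<in> L" using ih j' by auto
      then show False
        using L(1) ij False by (auto simp: increasing_matching_def single_valued_def)
    qed
  qed
  have agree: "\<forall>i. (i, j) \<in> M \<longleftrightarrow> (i, j) \<in> N" if "j \<in> Y" for j
    using Y that
  proof (induction "card {y \<in> Y. y < j}" arbitrary: j rule: less_induct)
    case less
    have ih: "(i, j') \<in> M \<longleftrightarrow> (i, j') \<in> N" if "j' < j" for i j'
    proof (cases "j' \<in> Y")
      case True
      have "{y \<in> Y. y < j'} \<subset> {y \<in> Y. y < j}" using True that by auto
      then have "card {y \<in> Y. y < j'} < card {y \<in> Y. y < j}"
        using Y by (intro psubset_card_mono) auto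
      then show ?thesis using less.hyps True Y by blast
    next
      case False
      then show ?thesis using M(4) N(4) by auto
    qed
    obtain i where i: "(i, j) \<in> M" using less.prems M(4) by auto
    obtain i' where i': "(i', j) \<in> N" using less.prems N(4) by auto
    have "\<not> w i < w i'" using step[OF M(1,2) N(1,3) ih i i'] by auto
    moreover have "\<not> w i' < w i" using step[OF N(1,2) M(1,3) ih[symmetric] i' i] by auto
    ultimately have "i = i'" using w by (metis injD linorder_neqE)
    then show ?case
      using i i' M(1) N(1) unfolding increasing_matching_def single_valued_def by blast
  qed
  have "(i, j) \<in> M \<longleftrightarrow> (i, j) \<in> N" for i j
    using agree[of j] M(4) N(4) by auto
  then show ?thesis by auto
qed

text \<open>Adding the largest closer \<open>c\<close> last never disturbs the choices already made.  The counting hypothesis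
at \<open>c\<close> says exactly that some opener below \<open>c\<close> is still free.\<close>

lemma greedy_matching_exists:
  fixes X Y :: "'a::linorder set" and w :: "'a \<Rightarrow> 'b::linorder"
  assumes "finite Y" and X: "finite X"
    and "\<forall>c\<in>Y. card (Y \<inter> {..c}) \<le> card (X \<inter> {..<c})"
  shows "\<exists>M. increasing_matching M \<and> greedy w X M \<and> Domain M \<subseteq> X \<and> Range M = Y"
  using assms(1,3)
proof (induction Y rule: finite_linorder_max_induct)
  case empty
  show ?case
    by (rule exI[of _ "{}"]) (auto simp: increasing_matching_def greedy_def single_valued_def)
next
  case (insert c Y)
  have "card (Y \<inter> {..d}) \<le> card (X \<inter> {..<d})" if "d \<in> Y" for d
  proof -
    have "insert c Y \<inter> {..d} = Y \<inter> {..d}" using insert.hyps that by auto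
    then show ?thesis using insert.prems that by (metis insertI2)
  qed
  then obtain M where M: "increasing_matching M" "greedy w X M" "Domain M \<subseteq> X" "Range M = Y"
    using insert.IH by blast
  have "inj_on snd M"
    using M(1) by (auto simp: inj_on_def increasing_matching_def single_valued_def)
  moreover have "snd ` M = Y" using M(4) by (auto simp: Range_snd)
  ultimately have cM: "card M = card Y" and fM: "finite M"
    using card_image[of snd M] insert.hyps(1) finite_image_iff[of snd M] by auto
  have "card (Domain M) \<le> card M"
    unfolding Domain_fst using fM by (rule card_image_le)
  also have "\<dots> < card (insert c Y)" using cM insert.hyps by auto
  also have "insert c Y = insert c Y \<inter> {..c}" using insert.hyps by auto
  also have "card \<dots> \<le> card (X \<inter> {..<c})" using insert.prems by blast
  finally have "\<not> X \<inter> {..<c} \<subseteq> Domain M"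
    using fM by (metis card_mono finite_Domain not_less)
  then have ne: "X \<inter> {..<c} - Domain M \<noteq> {}" by auto
  define m where "m = Max (w ` (X \<inter> {..<c} - Domain M))"
  have "m \<in> w ` (X \<inter> {..<c} - Domain M)"
    unfolding m_def using ne X by (intro Max_in) auto
  then obtain i where i: "i \<in> X" "i < c" "i \<notin> Domain M" "w i = m" by auto
  have best: "r \<in> Domain M" if "r \<in> X" "r < c" "w i < w r" for r
  proof (rule ccontr)
    assume "r \<notin> Domain M"
    then have "w r \<le> m" unfolding m_def using that X by (intro Max_ge) auto
    then show False using that i by auto
  qed
  have "increasing_matching (insert (i, c) M)"
    using M(1) i M(4) insert.hyps
    by (auto simp: increasing_matching_def single_valued_def)
  moreover have "greedy w X (insert (i, c) M)"
    unfolding greedy_def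
  proof safe
    fix r assume r: "r \<in> X" "w i < w r" "r < c"
    then obtain j' where "(r, j') \<in> M" using best by blast
    moreover from this have "j' \<in> Y" using M(4) by blast
    then have "j' \<le> c" using insert.hyps by (simp add: less_imp_le)
    ultimately show "\<exists>j'\<le>c. (r, j') \<in> insert (i, c) M" by auto
  next
    fix a j r assume "(a, j) \<in> M" "r \<in> X" "w a < w r" "r < j"
    then show "\<exists>j'\<le>j. (r, j') \<in> insert (i, c) M"
      using M(2) unfolding greedy_def by blast
  qed
  ultimately show ?case using i M by (intro exI[of _ "insert (i, c) M"]) auto
qed

section \<open>Involutions without crossings or nestings\<close>

definition involution_on :: "'a set \<Rightarrow> ('a \<times> 'a) set \<Rightarrow> bool" where
  "involution_on R S \<longleftrightarrow> Domain S = R \<and> sym S \<and> single_valued S"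

definition fixes_at_most_one :: "('a \<times> 'a) set \<Rightarrow> bool" where
  "fixes_at_most_one S \<longleftrightarrow> (\<forall>i j. (i, i) \<in> S \<longrightarrow> (j, j) \<in> S \<longrightarrow> i = j)"

definition antitone_rel :: "('a::linorder \<times> 'a) set \<Rightarrow> bool" where
  "antitone_rel S \<longleftrightarrow> (\<forall>(i, j)\<in>S. \<forall>(i', j')\<in>S. i < i' \<longrightarrow> j' < j)"

text \<open>The arcs from a positive to a negative element are encoded by the pairs \<open>(i, j)\<close> such that \<open>(i, - j)\<close> is
an arc.  A pair with \<open>i \<le> j\<close> is an arc whose closer is not smaller than its opener; among the arcs that
pass from positive to negative elements, a crossing or nesting is counted only for two of this kind.\<close>

definition mid_noncrossing :: "('a::linorder \<times> 'a) set \<Rightarrow> bool" where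
  "mid_noncrossing S \<longleftrightarrow>
     (\<forall>(i, j)\<in>S. \<forall>(i', j')\<in>S. \<not> (i \<le> j \<and> i' \<le> j' \<and> i < i' \<and> j < j'))"

text \<open>In the nesting diagram the arc \<open>(i, - i)\<close> is replaced by \<open>(i, 0)\<close> and \<open>(0, - i)\<close>.  Since \<open>0\<close> lies in the
middle, \<open>(i', 0)\<close> is inside \<open>(i, - j)\<close> as soon as \<open>i < i'\<close>, whatever \<open>j\<close> is; this is the alternative
\<open>i' = j'\<close>.  The arc \<open>(i, 0)\<close> in turn encloses no arc that reaches \<open>0\<close> or a negative element,
whence the strict \<open>i < j\<close>.\<close>

definition mid_nonnesting :: "('a::linorder \<times> 'a) set \<Rightarrow> bool" where
  "mid_nonnesting S \<longleftrightarrow>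
     (\<forall>(i, j)\<in>S. \<forall>(i', j')\<in>S. \<not> (i < j \<and> i' \<le> j' \<and> i < i' \<and> (i' = j' \<or> j < j')))"

text \<open>Let \<open>i\<close> be the first point where two order-reversing involutions differ, with images \<open>j < j'\<close>.  The
partner of \<open>j'\<close> under the first involution comes before \<open>i\<close>, so it is also its partner under the second;
but there \<open>j'\<close> belongs to \<open>i\<close>.\<close>

lemma reversal_unique:
  fixes S T :: "('a::linorder \<times> 'a) set"
  assumes S: "involution_on R S" "antitone_rel S" and T: "involution_on R T" "antitone_rel T"
    and R: "finite R"
  shows "S = T"
proof -
  have step: False
    if K: "involution_on R K" "antitone_rel K" and L: "involution_on R L"
      and ih: "\<And>k j. k < i \<Longrightarrow> (k, j) \<in> K \<longleftrightarrow> (k, j) \<in> L"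
      and ij: "(i, j) \<in> K" "(i, j') \<in> L" "j < j'" for K L and i j j' :: 'a
  proof -
    have "j' \<in> R" using L ij by (auto simp: involution_on_def sym_def)
    then obtain k where k: "(k, j') \<in> K"
      using K(1) by (auto simp: involution_on_def sym_def)
    have "k < i"
    proof (rule ccontr)
      assume "\<not> k < i"
      then consider "k = i" | "i < k" by force
      then show False
      proof cases
        case 1
        then show False using k ij K(1) by (auto simp: involution_on_def single_valued_def)
      next
        case 2
        then show False using k ij K(2) unfolding antitone_rel_def by fastforce
      qed
    qed
    then have "(k, j') \<in> L" using ih k by auto
    then have "k = i" using ij L unfolding involution_on_def sym_def single_valued_def by blast
    then show False using \<open>k < i\<close> by auto
  qed
  have agree: "\<forall>j. (i, j) \<in> S \<longleftrightarrow> (i, j) \<in> T" if "i \<in> R" for i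
    using R that
  proof (induction "card {y \<in> R. y < i}" arbitrary: i rule: less_induct)
    case less
    have ih: "(k, j) \<in> S \<longleftrightarrow> (k, j) \<in> T" if "k < i" for k j
    proof (cases "k \<in> R")
      case True
      have "{y \<in> R. y < k} \<subset> {y \<in> R. y < i}" using True that by auto
      then have "card {y \<in> R. y < k} < card {y \<in> R. y < i}"
        using R by (intro psubset_card_mono) auto
      then show ?thesis using less.hyps True R by blast
    next
      case False
      then show ?thesis using S(1) T(1) by (auto simp: involution_on_def)
    qed
    obtain j where j: "(i, j) \<in> S" using less.prems S(1) by (auto simp: involution_on_def)
    obtain j' where j': "(i, j') \<in> T" using less.prems T(1) by (auto simp: involution_on_def)
    have "\<not> j < j'" using step[OF S T(1) ih j j'] by auto
    moreover have "\<not> j' < j" using step[OF T S(1) ih[symmetric] j' j] by auto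
    ultimately have "j = j'" by auto
    then show ?case
      using j j' S(1) T(1) unfolding involution_on_def single_valued_def by blast
  qed
  have "(i, j) \<in> S \<longleftrightarrow> (i, j) \<in> T" for i j
    using agree[of i] S(1) T(1) by (auto simp: involution_on_def)
  then show ?thesis by auto
qed

text \<open>Exchange the two extreme points and recurse.  The parity of \<open>R\<close> decides whether a middle point is
left over, and that point is the only possible fixed point.\<close>

lemma reversal_exists:
  fixes R :: "'a::linorder set"
  assumes "finite R"
  shows "\<exists>S. involution_on R S \<and> antitone_rel S \<and> (odd (card R) \<longleftrightarrow> (\<exists>i. (i, i) \<in> S))"
  using assms
proof (induction "card R" arbitrary: R rule: less_induct)
  case less
  consider "R = {}" | x where "R = {x}" | a b where "a \<in> R" "b \<in> R" "a < b"
    by (metis all_not_in_conv insertI1 linorder_neqE subset_singletonD subsetI)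
  then show ?case
  proof cases
    case 1
    then show ?thesis
      by (intro exI[of _ "{}"]) (auto simp: involution_on_def antitone_rel_def sym_def)
  next
    case (2 x)
    then show ?thesis
      by (intro exI[of _ "{(x, x)}"])
        (auto simp: involution_on_def antitone_rel_def sym_def single_valued_def)
  next
    case (3 a b)
    define l where "l = Min R"
    define u where "u = Max R"
    have lu: "l \<in> R" "u \<in> R" and between: "\<And>r. r \<in> R \<Longrightarrow> l \<le> r \<and> r \<le> u"
      unfolding l_def u_def using less.prems 3 by (auto intro!: Min_in Max_in)
    have "l < u" using between[OF 3(1)] between[OF 3(2)] 3(3) by auto
    have strict: "l < r \<and> r < u" if "r \<in> R - {l, u}" for r
      using between[of r] that by force
    have card: "card R = card (R - {l, u}) + 2"
    proof -
      have "R = insert l (insert u (R - {l, u}))" using lu by auto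
      then have "card R = card (insert l (insert u (R - {l, u})))" by simp
      also have "\<dots> = card (R - {l, u}) + 2" using \<open>l < u\<close> less.prems by simp
      finally show ?thesis .
    qed
    then obtain S where S: "involution_on (R - {l, u}) S" "antitone_rel S"
      and odd: "odd (card (R - {l, u})) \<longleftrightarrow> (\<exists>i. (i, i) \<in> S)"
      using less.hyps[of "R - {l, u}"] less.prems by auto
    have SR: "i \<in> R - {l, u} \<and> j \<in> R - {l, u}" if "(i, j) \<in> S" for i j
      using S(1) that unfolding involution_on_def sym_def by blast
    let ?S = "insert (l, u) (insert (u, l) S)"
    have "Domain ?S = R" "sym ?S" "single_valued ?S"
      using S(1) lu \<open>l < u\<close> SR
      by (auto simp: involution_on_def sym_def single_valued_def)
    then have "involution_on R ?S" by (simp add: involution_on_def)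
    moreover have "j' < j" if "(i, j) \<in> ?S" "(i', j') \<in> ?S" "i < i'" for i j i' j'
    proof -
      have "(i, j) \<in> S \<and> (i', j') \<in> S \<Longrightarrow> j' < j"
        using S(2) that(3) unfolding antitone_rel_def by blast
      then show ?thesis
        using that SR[of i j] SR[of i' j'] strict[of i] strict[of j] strict[of i'] strict[of j']
          \<open>l < u\<close> by auto
    qed
    then have "antitone_rel ?S" unfolding antitone_rel_def by blast
    moreover have "odd (card R) \<longleftrightarrow> (\<exists>i. (i, i) \<in> ?S)"
      using odd card \<open>l < u\<close> by auto
    ultimately show ?thesis by blast
  qed
qed

text \<open>The condition speaks only of pairs \<open>(i, j)\<close> with \<open>i \<le> j\<close>.  This suffices, because any two pairs of
a symmetric relation that preserve the order, say \<open>i < i'\<close> and \<open>j < j'\<close>, yield two such pairs that also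
preserve it once each pair is flipped to be increasing.\<close>

lemma mid_noncrossing_iff_antitone:
  assumes "involution_on R S"
  shows "mid_noncrossing S \<longleftrightarrow> antitone_rel S"
proof
  assume "antitone_rel S"
  then show "mid_noncrossing S"
    unfolding antitone_rel_def mid_noncrossing_def by fastforce
next
  assume nc: "mid_noncrossing S"
  have up: False if "(i, j) \<in> S" "(i', j') \<in> S" "i \<le> j" "i' \<le> j'" "i < i'" "j < j'" for i j i' j'
    using nc that unfolding mid_noncrossing_def by blast
  have sym: "(j, i) \<in> S" if "(i, j) \<in> S" for i j
    using assms that unfolding involution_on_def sym_def by blast
  have "j' < j" if ij: "(i, j) \<in> S" "(i', j') \<in> S" "i < i'" for i j i' j'
  proof (rule ccontr)
    assume "\<not> j' < j"
    moreover have "j \<noteq> j'"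
      using ij sym[of i j] sym[of i' j'] assms unfolding involution_on_def single_valued_def
      by blast
    ultimately have jj: "j < j'" by auto
    \<comment> \<open>one instance of "up" for each choice of the pairs to be flipped\<close>
    show False
      using up[of i j i' j'] up[of j i j' i'] up[of i j j' i'] up[of j i i' j'] ij jj
        sym[of i j] sym[of i' j'] by force
  qed
  then show "antitone_rel S" unfolding antitone_rel_def by blast
qed

lemma ex1_mid_noncrossing:
  assumes "finite R"
  shows "\<exists>!S. involution_on R S \<and> fixes_at_most_one S \<and> mid_noncrossing S"
proof -
  have "fixes_at_most_one S" if "antitone_rel S" for S :: "('a \<times> 'a) set"
    using that unfolding antitone_rel_def fixes_at_most_one_def
    by (metis (no_types, lifting) case_prodD linorder_neqE order_less_asym)
  then show ?thesis
    using reversal_exists[OF assms] reversal_unique[OF _ _ _ _ assms]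
      mid_noncrossing_iff_antitone[of R] by metis
qed

text \<open>If \<open>i < f\<close> has the partner \<open>j\<close>, then the arc from the smaller of \<open>i\<close> and \<open>j\<close> to the negative of the larger
starts before \<open>f\<close> and would enclose \<open>(f, 0)\<close>.\<close>

lemma mid_nonnesting_fixpoint_least:
  assumes S: "involution_on R S" "fixes_at_most_one S" "mid_nonnesting S"
    and f: "(f, f) \<in> S" and "i \<in> R"
  shows "f \<le> i"
proof (rule ccontr)
  assume "\<not> f \<le> i"
  then have "i < f" by auto
  obtain j where j: "(i, j) \<in> S" "(j, i) \<in> S"
    using S(1) \<open>i \<in> R\<close> unfolding involution_on_def sym_def by blast
  have "i \<noteq> j" using S(2) f j \<open>i < f\<close> unfolding fixes_at_most_one_def by auto
  have up: "\<not> (a < b \<and> a < f)" if "(a, b) \<in> S" for a b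
    using S(3) f that unfolding mid_nonnesting_def by blast
  show False using up[OF j(1)] up[OF j(2)] \<open>i \<noteq> j\<close> \<open>i < f\<close> by force
qed

text \<open>Apart from the fixed point, which must be the minimum, the condition agrees with that for
crossings, so what remains is an order reversal without fixed points.  Such a reversal lives on a set of even
size; hence the parity of \<open>R\<close> decides which of the two cases occurs.\<close>

lemma mid_nonnesting_cases:
  assumes R: "finite R" and S: "involution_on R S" "fixes_at_most_one S" "mid_nonnesting S"
  shows "(even (card R) \<and> antitone_rel S) \<or>
    (odd (card R) \<and> (Min R, Min R) \<in> S \<and>
       involution_on (R - {Min R}) (S - {(Min R, Min R)}) \<and> antitone_rel (S - {(Min R, Min R)}))"
proof -
  have odd: "odd (card Q) \<longleftrightarrow> (\<exists>i. (i, i) \<in> T)"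
    if "involution_on Q T" "antitone_rel T" "finite Q" for Q T
    using reversal_exists[OF that(3)] reversal_unique[OF that(1,2) _ _ that(3)] by metis
  show ?thesis
  proof (cases "\<exists>f. (f, f) \<in> S")
    case False
    then have "mid_noncrossing S"
      using S(3) unfolding mid_nonnesting_def mid_noncrossing_def by fastforce
    then show ?thesis
      using odd[OF S(1) _ R] mid_noncrossing_iff_antitone[OF S(1)] False by blast
  next
    case True
    then obtain f where f: "(f, f) \<in> S" by auto
    then have fR: "f \<in> R" using S(1) unfolding involution_on_def by blast
    have fM: "f = Min R"
      using mid_nonnesting_fixpoint_least[OF S f] fR R by (metis Min_eqI)
    have inv: "involution_on (R - {f}) (S - {(f, f)})"
      using S(1) f unfolding involution_on_def sym_def single_valued_def by blast
    have nofix: "\<not> (\<exists>i. (i, i) \<in> S - {(f, f)})"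
      using S(2) f unfolding fixes_at_most_one_def by blast
    have "mid_noncrossing (S - {(f, f)})"
      using S(3) nofix unfolding mid_nonnesting_def mid_noncrossing_def by fastforce
    then have anti: "antitone_rel (S - {(f, f)})"
      using mid_noncrossing_iff_antitone[OF inv] by blast
    have "even (card (R - {f}))" using odd[OF inv anti] R nofix by blast
    then have "odd (card R)" using card_Suc_Diff1[OF R fR] by (metis even_Suc)
    then show ?thesis using inv anti f fM by blast
  qed
qed

lemma ex1_mid_nonnesting:
  assumes R: "finite R"
  shows "\<exists>!S. involution_on R S \<and> fixes_at_most_one S \<and> mid_nonnesting S"
proof (rule ex_ex1I)
  show "\<exists>S. involution_on R S \<and> fixes_at_most_one S \<and> mid_nonnesting S"
  proof (cases "even (card R)")
    case True
    then obtain S where S: "involution_on R S" "antitone_rel S" "\<not> (\<exists>i. (i, i) \<in> S)"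
      using reversal_exists[OF R] by blast
    then have "fixes_at_most_one S" "mid_nonnesting S"
      unfolding fixes_at_most_one_def mid_nonnesting_def antitone_rel_def by fastforce+
    then show ?thesis using S by blast
  next
    case False
    define m where "m = Min R"
    have "R \<noteq> {}" using False by auto
    then have m: "m \<in> R" and least: "\<And>i. i \<in> R - {m} \<Longrightarrow> m < i"
      using R by (auto simp: m_def less_le)
    have "even (card (R - {m}))" using False m R by simp
    then obtain S where S: "involution_on (R - {m}) S" "antitone_rel S" "\<not> (\<exists>i. (i, i) \<in> S)"
      using reversal_exists[of "R - {m}"] R by blast
    have SR: "i \<in> R - {m} \<and> j \<in> R - {m}" if "(i, j) \<in> S" for i j
      using S(1) that unfolding involution_on_def sym_def by blast
    have "Domain (insert (m, m) S) = R" "sym (insert (m, m) S)" "single_valued (insert (m, m) S)"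
      using S(1) m SR by (auto simp: involution_on_def sym_def single_valued_def)
    then have "involution_on R (insert (m, m) S)" by (simp add: involution_on_def)
    moreover have "fixes_at_most_one (insert (m, m) S)"
      using S(3) unfolding fixes_at_most_one_def by blast
    moreover have "\<not> (i < j \<and> i' \<le> j' \<and> i < i' \<and> (i' = j' \<or> j < j'))"
      if "(i, j) \<in> insert (m, m) S" "(i', j') \<in> insert (m, m) S" for i j i' j'
    proof -
      have "(i, j) \<in> S \<and> (i', j') \<in> S \<Longrightarrow> i < i' \<Longrightarrow> j' < j"
        using S(2) unfolding antitone_rel_def by blast
      moreover have "(i', j') \<in> S \<Longrightarrow> i' \<noteq> j'" using S(3) by blast
      ultimately show ?thesis
        using that SR[of i j] least[of i] by auto
    qed
    then have "mid_nonnesting (insert (m, m) S)" unfolding mid_nonnesting_def by blast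
    ultimately show ?thesis by blast
  qed
next
  fix S T
  assume S: "involution_on R S \<and> fixes_at_most_one S \<and> mid_nonnesting S"
    and T: "involution_on R T \<and> fixes_at_most_one T \<and> mid_nonnesting T"
  show "S = T"
  proof (cases "even (card R)")
    case True
    then show ?thesis
      using mid_nonnesting_cases[OF R, of S] mid_nonnesting_cases[OF R, of T] S T
        reversal_unique[of R S T] R by blast
  next
    case False
    then have "(Min R, Min R) \<in> S" "(Min R, Min R) \<in> T"
      "S - {(Min R, Min R)} = T - {(Min R, Min R)}"
      using mid_nonnesting_cases[OF R, of S] mid_nonnesting_cases[OF R, of T] S T
        reversal_unique[of "R - {Min R}" "S - {(Min R, Min R)}" "T - {(Min R, Min R)}"] R
      by blast+
    then show ?thesis by (metis insert_Diff)
  qed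
qed

section \<open>The nesting order and the arcs of a set partition\<close>

lemma nesting_less_trans: "nesting_less i j \<Longrightarrow> nesting_less j k \<Longrightarrow> nesting_less i k"
  unfolding nesting_less_def by arith

lemma nesting_less_irrefl: "\<not> nesting_less i i"
  unfolding nesting_less_def by arith

lemma nesting_less_linear: "nesting_less i j \<or> i = j \<or> nesting_less j i"
  unfolding nesting_less_def by arith

lemma nesting_less_uminus: "nesting_less (- i) (- j) \<longleftrightarrow> nesting_less j i"
  unfolding nesting_less_def by arith

lemma block_arcsI:
  "i \<in> B \<Longrightarrow> j \<in> B \<Longrightarrow> nesting_less i j \<Longrightarrow>
   (\<And>k. k \<in> B \<Longrightarrow> nesting_less i k \<Longrightarrow> nesting_less k j \<Longrightarrow> False) \<Longrightarrow> (i, j) \<in> block_arcs B"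
  unfolding block_arcs_def by blast

lemma block_arcsD:
  assumes "(i, j) \<in> block_arcs B"
  shows "i \<in> B" "j \<in> B" "nesting_less i j" "k \<in> B \<Longrightarrow> nesting_less i k \<Longrightarrow> \<not> nesting_less k j"
  using assms unfolding block_arcs_def by blast+

lemma block_arcs_uminus:
  assumes "(i, j) \<in> block_arcs B"
  shows "(- j, - i) \<in> block_arcs (uminus ` B)"
proof (rule block_arcsI)
  show "- j \<in> uminus ` B" "- i \<in> uminus ` B" "nesting_less (- j) (- i)"
    using block_arcsD(1-3)[OF assms] by (auto simp: nesting_less_uminus)
next
  fix k assume "k \<in> uminus ` B" "nesting_less (- j) k" "nesting_less k (- i)"
  then obtain l where "k = - l" "l \<in> B" "nesting_less l j" "nesting_less i l"
    by (auto simp: nesting_less_uminus)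
  then show False using block_arcsD(4)[OF assms] by blast
qed

text \<open>This recovers a block from its arcs: between any two elements of a finite block, the arcs form a
path.\<close>

lemma block_arcs_connect:
  assumes "finite B" "x \<in> B" "y \<in> B" "nesting_less x y"
  shows "(x, y) \<in> (block_arcs B)\<^sup>*"
  using assms
proof (induction "card {k \<in> B. nesting_less x k \<and> nesting_less k y}" arbitrary: x y
    rule: less_induct)
  case less
  show ?case
  proof (cases "\<exists>k\<in>B. nesting_less x k \<and> nesting_less k y")
    case False
    then have "(x, y) \<in> block_arcs B" using less.prems by (intro block_arcsI) auto
    then show ?thesis by blast
  next
    case True
    then obtain k where k: "k \<in> B" "nesting_less x k" "nesting_less k y" by blast
    let ?I = "\<lambda>x y. {k \<in> B. nesting_less x k \<and> nesting_less k y}"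
    have "?I x k \<subset> ?I x y" "?I k y \<subset> ?I x y"
      using k nesting_less_trans nesting_less_irrefl by blast+
    then have "card (?I x k) < card (?I x y)" "card (?I k y) < card (?I x y)"
      using less.prems(1) by (auto intro!: psubset_card_mono)
    then have "(x, k) \<in> (block_arcs B)\<^sup>*" "(k, y) \<in> (block_arcs B)\<^sup>*"
      using less.hyps less.prems k by blast+
    then show ?thesis by auto
  qed
qed

lemma finite_pm_interval: "finite (pm_interval n)"
  by (rule finite_subset[of _ "{- int n..int n}"]) (auto simp: pm_interval_def)

lemma set_partition_B_D:
  assumes "set_partition_B n P"
  shows "\<Union>P = pm_interval n" "B \<in> P \<Longrightarrow> uminus ` B \<in> P"
    "B \<in> P \<Longrightarrow> C \<in> P \<Longrightarrow> x \<in> B \<Longrightarrow> x \<in> C \<Longrightarrow> B = C"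
    "B \<in> P \<Longrightarrow> finite B" "B \<in> P \<Longrightarrow> 0 \<notin> B" "B \<in> P \<Longrightarrow> B \<noteq> {}"
    "B \<in> P \<Longrightarrow> C \<in> P \<Longrightarrow> is_zero_block B \<Longrightarrow> is_zero_block C \<Longrightarrow> B = C"
proof -
  have p: "partition_on (pm_interval n) P" and m: "\<And>B. B \<in> P \<longleftrightarrow> uminus ` B \<in> P"
    and z: "\<forall>B\<in>P. \<forall>B'\<in>P. is_zero_block B \<longrightarrow> is_zero_block B' \<longrightarrow> B = B'"
    using assms unfolding set_partition_B_def by blast+
  show U: "\<Union>P = pm_interval n" using partition_onD1[OF p] by simp
  show "B \<in> P \<Longrightarrow> uminus ` B \<in> P" using m by blast
  show "B \<in> P \<Longrightarrow> C \<in> P \<Longrightarrow> x \<in> B \<Longrightarrow> x \<in> C \<Longrightarrow> B = C"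
    using partition_onD2[OF p] unfolding disjoint_def by blast
  show "B \<in> P \<Longrightarrow> finite B"
    using U finite_pm_interval[of n] finite_subset[of B "pm_interval n"] by blast
  show "B \<in> P \<Longrightarrow> 0 \<notin> B" using U unfolding pm_interval_def by blast
  show "B \<in> P \<Longrightarrow> B \<noteq> {}" using partition_onD3[OF p] by blast
  show "B \<in> P \<Longrightarrow> C \<in> P \<Longrightarrow> is_zero_block B \<Longrightarrow> is_zero_block C \<Longrightarrow> B = C"
    using z by blast
qed

text \<open>A block and its mirror image are both blocks, so they coincide once they share an element.\<close>

lemma is_zero_block_iff_opposite:
  assumes P: "set_partition_B n P" and B: "B \<in> P" and "i \<in> B"
  shows "is_zero_block B \<longleftrightarrow> - i \<in> B"
proof
  assume "is_zero_block B"
  then show "- i \<in> B" using \<open>i \<in> B\<close> unfolding is_zero_block_def by blast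
next
  assume "- i \<in> B"
  moreover have "- i \<in> uminus ` B" using \<open>i \<in> B\<close> by blast
  ultimately show "is_zero_block B"
    using set_partition_B_D(2,3)[OF P] B unfolding is_zero_block_def by blast
qed

lemma crossing_arcs_uminus:
  assumes "set_partition_B n P" "(i, j) \<in> crossing_arcs P"
  shows "(- j, - i) \<in> crossing_arcs P"
  using assms block_arcs_uminus set_partition_B_D(2)[OF assms(1)]
  unfolding crossing_arcs_def by blast

lemma crossing_arcsD:
  assumes "set_partition_B n P" "(i, j) \<in> crossing_arcs P"
  shows "i \<in> pm_interval n" "j \<in> pm_interval n" "nesting_less i j"
  using assms(2) set_partition_B_D(1)[OF assms(1)] block_arcsD
  unfolding crossing_arcs_def by blast+

lemma single_valued_crossing_arcs:
  assumes "set_partition_B n P"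
  shows "single_valued (crossing_arcs P)"
proof (rule single_valuedI)
  fix i j k assume "(i, j) \<in> crossing_arcs P" "(i, k) \<in> crossing_arcs P"
  then obtain B C where B: "B \<in> P" "(i, j) \<in> block_arcs B"
    and C: "C \<in> P" "(i, k) \<in> block_arcs C"
    unfolding crossing_arcs_def by blast
  then have "B = C" using set_partition_B_D(3)[OF assms] block_arcsD(1) by blast
  then show "j = k"
    using B C block_arcsD[of i j B] block_arcsD[of i k B] nesting_less_linear[of j k] by blast
qed

text \<open>The block of \<open>x\<close> consists of the elements joined to \<open>x\<close> by a path of arcs, so the arcs determine the
partition.\<close>

lemma set_partition_B_eqI:
  assumes P: "set_partition_B n P" and Q: "set_partition_B n Q"
    and arcs: "crossing_arcs P = crossing_arcs Q"
  shows "P = Q"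
proof -
  have half: "B \<subseteq> C"
    if P: "set_partition_B n P" and Q: "set_partition_B n Q"
      and arcs: "crossing_arcs P = crossing_arcs Q"
      and B: "B \<in> P" and C: "C \<in> Q" and x: "x \<in> B" "x \<in> C" for P Q B C x
  proof
    fix y assume y: "y \<in> B"
    have closed: "k \<in> C" if "(i, k) \<in> (block_arcs B)\<^sup>*" "i \<in> C" for i k
      using that
    proof (induction rule: rtrancl_induct)
      case (step k l)
      then have "(k, l) \<in> crossing_arcs Q"
        using B arcs unfolding crossing_arcs_def by blast
      then show ?case
        using step C set_partition_B_D(3)[OF Q] block_arcsD(1,2) unfolding crossing_arcs_def
        by blast
    qed
    have closed': "i \<in> C" if "(i, k) \<in> (block_arcs B)\<^sup>*" "k \<in> C" for i k
      using that
    proof (induction rule: converse_rtrancl_induct)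
      case (step i l)
      then have "(i, l) \<in> crossing_arcs Q"
        using B arcs unfolding crossing_arcs_def by blast
      then show ?case
        using step C set_partition_B_D(3)[OF Q] block_arcsD(1,2) unfolding crossing_arcs_def
        by blast
    qed
    show "y \<in> C"
      using nesting_less_linear[of x y] block_arcs_connect[OF set_partition_B_D(4)[OF P B]]
        x y closed closed' by blast
  qed
  have sub: "B \<in> Q"
    if P: "set_partition_B n P" and Q: "set_partition_B n Q"
      and arcs: "crossing_arcs P = crossing_arcs Q" and B: "B \<in> P" for P Q B
  proof -
    obtain x where x: "x \<in> B" using set_partition_B_D(6)[OF P B] by blast
    then obtain C where C: "C \<in> Q" "x \<in> C"
      using set_partition_B_D(1)[OF P] set_partition_B_D(1)[OF Q] B by blast
    then have "B = C"
      using half[OF P Q arcs B] half[OF Q P arcs[symmetric] _ B] x by blast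
    then show ?thesis using C by simp
  qed
  show ?thesis using sub[OF P Q arcs] sub[OF Q P arcs[symmetric]] by blast
qed

section \<open>Half diagrams\<close>

definition pos_arcs :: "int set set \<Rightarrow> (int \<times> int) set" where
  "pos_arcs P = {(i, j). 0 < i \<and> 0 < j \<and> (i, j) \<in> crossing_arcs P}"

definition mid_arcs :: "int set set \<Rightarrow> (int \<times> int) set" where
  "mid_arcs P = {(i, j). 0 < i \<and> 0 < j \<and> (i, - j) \<in> crossing_arcs P}"

text \<open>By the symmetry \<open>B \<mapsto> - B\<close> a crossing diagram is determined by its arcs \<open>M\<close> between positive elements and by the
relation \<open>S\<close> that describes the arcs from \<open>i\<close> to \<open>- j\<close>.  The conditions below are those that make the
mirrored diagram a disjoint union of increasing paths, invariant under the symmetry, with at most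
one path that is its own mirror image.\<close>

definition half_diagram :: "nat \<Rightarrow> (int \<times> int) set \<Rightarrow> (int \<times> int) set \<Rightarrow> bool" where
  "half_diagram n M S \<longleftrightarrow>
     M \<subseteq> {1..int n} \<times> {1..int n} \<and> S \<subseteq> {1..int n} \<times> {1..int n} \<and>
     increasing_matching M \<and> sym S \<and> single_valued S \<and> fixes_at_most_one S \<and>
     Domain M \<inter> Domain S = {}"

definition full_diagram :: "(int \<times> int) set \<Rightarrow> (int \<times> int) set \<Rightarrow> (int \<times> int) set" where
  "full_diagram M S = M \<union> {(- j, - i) |i j. (i, j) \<in> M} \<union> {(i, - j) |i j. (i, j) \<in> S}"

text \<open>A zero block passes from positive to negative elements at its largest positive element \<open>i\<close>, and by
symmetry it arrives at \<open>- i\<close>.  So the zero block shows up among the arcs as the arc \<open>(i, - i)\<close>.\<close>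

lemma zero_arc:
  assumes B: "finite B" "0 \<notin> B" "B \<noteq> {}" "is_zero_block B"
  obtains i where "0 < i" "i \<in> B" "(i, - i) \<in> block_arcs B"
proof
  define i where "i = Max {k \<in> B. 0 < k}"
  have op: "- k \<in> B" if "k \<in> B" for k
    using B(4) that unfolding is_zero_block_def by blast
  have nz: "k \<noteq> 0" if "k \<in> B" for k using B(2) that by blast
  obtain x where "x \<in> B" using B(3) by blast
  then have "(x \<in> B \<and> 0 < x) \<or> (- x \<in> B \<and> 0 < - x)" using op nz by fastforce
  then have "{k \<in> B. 0 < k} \<noteq> {}" by blast
  then have i: "i \<in> B" "0 < i" and max: "\<And>k. k \<in> B \<Longrightarrow> 0 < k \<Longrightarrow> k \<le> i"
    using Max_in[of "{k \<in> B. 0 < k}"] B(1) unfolding i_def by auto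
  then show "0 < i" "i \<in> B" by simp_all
  show "(i, - i) \<in> block_arcs B"
  proof (rule block_arcsI)
    fix k assume k: "k \<in> B" "nesting_less i k" "nesting_less k (- i)"
    then show False
      using i nz[OF k(1)] max[OF k(1)] max[OF op[OF k(1)]] unfolding nesting_less_def by auto
  qed (use i op in \<open>auto simp: nesting_less_def\<close>)
qed

text \<open>Two arcs \<open>(i, - i)\<close> and \<open>(j, - j)\<close> would both lie in the one zero block, and a block passes from positive
to negative elements only once.\<close>

lemma opposite_arc_unique:
  assumes P: "set_partition_B n P"
    and i: "(i, - i) \<in> crossing_arcs P" and j: "(j, - j) \<in> crossing_arcs P"
  shows "i = j"
proof -
  obtain B C where B: "B \<in> P" "(i, - i) \<in> block_arcs B" and C: "C \<in> P" "(j, - j) \<in> block_arcs C"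
    using i j unfolding crossing_arcs_def by blast
  have "is_zero_block B" "is_zero_block C"
    using B C is_zero_block_iff_opposite[OF P] block_arcsD(1,2) by blast+
  then have "B = C" using set_partition_B_D(7)[OF P] B C by blast
  then have "i \<in> B" "j \<in> B" "nesting_less i (- i)" "nesting_less j (- j)"
    using block_arcsD(1,3)[OF B(2)] block_arcsD(1,3)[OF C(2)] by simp_all
  moreover from this have "\<not> (nesting_less i j \<and> nesting_less j (- i))"
    "\<not> (nesting_less j i \<and> nesting_less i (- j))"
    using block_arcsD(4)[OF B(2), of j] block_arcsD(4)[OF C(2), of i] \<open>B = C\<close> by blast+
  moreover from \<open>nesting_less i (- i)\<close> \<open>nesting_less j (- j)\<close> have "0 < i" "0 < j"
    unfolding nesting_less_def by auto
  ultimately show ?thesis unfolding nesting_less_def by auto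
qed

lemma half_diagram_of_partition:
  assumes P: "set_partition_B n P"
  shows "half_diagram n (pos_arcs P) (mid_arcs P)"
proof -
  note sv = single_valuedD[OF single_valued_crossing_arcs[OF P]]
  note D = crossing_arcsD[OF P]
  note m = crossing_arcs_uminus[OF P]
  have m': "(j, - i) \<in> crossing_arcs P" if "(i, - j) \<in> crossing_arcs P" for i j
    using m[OF that] by simp
  have "pos_arcs P \<subseteq> {1..int n} \<times> {1..int n}"
    using D(1,2) unfolding pos_arcs_def pm_interval_def by force
  moreover have "mid_arcs P \<subseteq> {1..int n} \<times> {1..int n}"
    using D(1,2) unfolding mid_arcs_def pm_interval_def by force
  moreover have "i < j" if "(i, j) \<in> pos_arcs P" for i j
    using that D(3)[of i j] unfolding pos_arcs_def nesting_less_def by auto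
  moreover have "i = j" if "(i, k) \<in> pos_arcs P" "(j, k) \<in> pos_arcs P" for i j k
    using that sv[OF m m, of i k j] unfolding pos_arcs_def by auto
  moreover have "i = j" if "(k, i) \<in> pos_arcs P" "(k, j) \<in> pos_arcs P" for i j k
    using that sv unfolding pos_arcs_def by auto
  moreover have "sym (mid_arcs P)"
    unfolding sym_def mid_arcs_def using m' by blast
  moreover have "i = j" if "(k, i) \<in> mid_arcs P" "(k, j) \<in> mid_arcs P" for i j k
    using that sv unfolding mid_arcs_def by force
  moreover have "fixes_at_most_one (mid_arcs P)"
    unfolding fixes_at_most_one_def mid_arcs_def using opposite_arc_unique[OF P] by blast
  moreover have "j = - k" if "(i, j) \<in> pos_arcs P" "(i, k) \<in> mid_arcs P" for i j k
    using that sv[of i j "- k"] unfolding pos_arcs_def mid_arcs_def by blast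
  then have "Domain (pos_arcs P) \<inter> Domain (mid_arcs P) = {}"
    unfolding pos_arcs_def mid_arcs_def by fastforce
  ultimately show ?thesis
    unfolding half_diagram_def increasing_matching_def single_valued_def by blast
qed

lemma crossing_arcs_eq_full_diagram:
  assumes P: "set_partition_B n P"
  shows "crossing_arcs P = full_diagram (pos_arcs P) (mid_arcs P)"
proof -
  note D = crossing_arcsD[OF P]
  note m = crossing_arcs_uminus[OF P]
  have m': "(i, j) \<in> crossing_arcs P" if "(- j, - i) \<in> crossing_arcs P" for i j
    using m[OF that] by simp
  have "(i, j) \<in> full_diagram (pos_arcs P) (mid_arcs P)" if a: "(i, j) \<in> crossing_arcs P" for i j
  proof -
    have "i \<noteq> 0" "j \<noteq> 0" "nesting_less i j"
      using D[OF a] unfolding pm_interval_def by auto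
    then consider "0 < i" "0 < j" | "0 < i" "j < 0" | "i < 0" "j < 0"
      unfolding nesting_less_def by fastforce
    then show ?thesis
    proof cases
      case 1
      then show ?thesis using a unfolding full_diagram_def pos_arcs_def by auto
    next
      case 2
      then have "(i, - j) \<in> mid_arcs P" using a unfolding mid_arcs_def by auto
      then have "(i, - (- j)) \<in> full_diagram (pos_arcs P) (mid_arcs P)"
        unfolding full_diagram_def by blast
      then show ?thesis by simp
    next
      case 3
      then have "(- j, - i) \<in> pos_arcs P" using m[OF a] unfolding pos_arcs_def by auto
      then have "(- (- i), - (- j)) \<in> full_diagram (pos_arcs P) (mid_arcs P)"
        unfolding full_diagram_def by blast
      then show ?thesis by simp
    qed
  qed
  moreover have "full_diagram (pos_arcs P) (mid_arcs P) \<subseteq> crossing_arcs P"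
    unfolding full_diagram_def pos_arcs_def mid_arcs_def using m by blast
  ultimately show ?thesis by auto
qed

lemma half_diagram_pos:
  assumes "half_diagram n M S"
  shows "(i, j) \<in> M \<Longrightarrow> 0 < i \<and> i < j \<and> j \<le> int n"
    "(i, j) \<in> S \<Longrightarrow> 0 < i \<and> i \<le> int n \<and> 0 < j \<and> j \<le> int n"
  using assms unfolding half_diagram_def increasing_matching_def by fastforce+

lemma full_diagram_iff:
  assumes "half_diagram n M S"
  shows "(x, y) \<in> full_diagram M S \<longleftrightarrow>
    (0 < x \<and> 0 < y \<and> (x, y) \<in> M) \<or> (x < 0 \<and> y < 0 \<and> (- y, - x) \<in> M) \<or>
    (0 < x \<and> y < 0 \<and> (x, - y) \<in> S)"
proof -
  have "(x, y) \<in> full_diagram M S \<longleftrightarrow> (x, y) \<in> M \<or> (- y, - x) \<in> M \<or> (x, - y) \<in> S"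
    unfolding full_diagram_def by (auto simp: minus_equation_iff[of _ x] minus_equation_iff[of _ y])
  then show ?thesis using half_diagram_pos[OF assms] by fastforce
qed

lemma half_diagram_eq:
  assumes "half_diagram n M S"
  shows "{(i, j). 0 < i \<and> 0 < j \<and> (i, j) \<in> full_diagram M S} = M"
    "{(i, j). 0 < i \<and> 0 < j \<and> (i, - j) \<in> full_diagram M S} = S"
proof -
  show "{(i, j). 0 < i \<and> 0 < j \<and> (i, j) \<in> full_diagram M S} = M"
    using half_diagram_pos(1)[OF assms] unfolding full_diagram_iff[OF assms] by fastforce
  show "{(i, j). 0 < i \<and> 0 < j \<and> (i, - j) \<in> full_diagram M S} = S"
    using half_diagram_pos(2)[OF assms] unfolding full_diagram_iff[OF assms] by fastforce
qed

lemma full_diagram_props: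
  assumes H: "half_diagram n M S"
  shows "(i, j) \<in> full_diagram M S \<Longrightarrow> i \<in> pm_interval n \<and> j \<in> pm_interval n"
    "(i, j) \<in> full_diagram M S \<Longrightarrow> nesting_less i j"
    "(i, j) \<in> full_diagram M S \<Longrightarrow> (- j, - i) \<in> full_diagram M S"
    "single_valued (full_diagram M S)"
    "(i, - i) \<in> full_diagram M S \<Longrightarrow> (j, - j) \<in> full_diagram M S \<Longrightarrow> i = j"
proof -
  note rng = half_diagram_pos[OF H]
  have S: "sym S" "single_valued S" "fixes_at_most_one S" "Domain M \<inter> Domain S = {}"
    and M: "single_valued M" "single_valued (M\<inverse>)"
    using H unfolding half_diagram_def increasing_matching_def by blast+
  note iff = full_diagram_iff[OF H]
  show "(i, j) \<in> full_diagram M S \<Longrightarrow> i \<in> pm_interval n \<and> j \<in> pm_interval n"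
    unfolding iff pm_interval_def using rng[of i j] rng[of "- j" "- i"] rng[of i "- j"] by auto
  show "(i, j) \<in> full_diagram M S \<Longrightarrow> nesting_less i j"
    unfolding iff nesting_less_def using rng[of i j] rng[of "- j" "- i"] rng[of i "- j"] by auto
  show "(i, j) \<in> full_diagram M S \<Longrightarrow> (- j, - i) \<in> full_diagram M S"
    unfolding iff using symD[OF S(1)] by auto
  show "single_valued (full_diagram M S)"
  proof (rule single_valuedI)
    fix x y z assume "(x, y) \<in> full_diagram M S" "(x, z) \<in> full_diagram M S"
    moreover have "\<not> ((x, j) \<in> M \<and> (x, k) \<in> S)" for j k using S(4) by blast
    ultimately show "y = z"
      unfolding iff
      using single_valuedD[OF S(2), of x "- y" "- z"] single_valuedD[OF M(1), of x y z]
        single_valuedD[OF M(2), of "- x" "- y" "- z"] by auto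
  qed
  show "(i, - i) \<in> full_diagram M S \<Longrightarrow> (j, - j) \<in> full_diagram M S \<Longrightarrow> i = j"
    unfolding iff using S(3) by (auto simp: fixes_at_most_one_def)
qed

section \<open>From half diagrams to partitions\<close>

lemma mirror_rtrancl:
  assumes "\<And>i j. (i, j) \<in> A \<Longrightarrow> (- j, - i) \<in> A" and "(i, j) \<in> A\<^sup>*"
  shows "(- j, - i :: int) \<in> A\<^sup>*"
  using assms(2)
proof (induction rule: rtrancl_induct)
  case (step j k)
  then show ?case using assms(1)[of j k] by (meson converse_rtrancl_into_rtrancl)
qed simp

text \<open>The blocks are the connected components of the arcs.  As every element has at most one outgoing and
one incoming arc and arcs increase in the nesting order, a component is a path visited in increasing
order, and therefore its arcs are the given ones.\<close>

lemma partition_of_half_diagram: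
  assumes H: "half_diagram n M S"
  obtains P where "set_partition_B n P" "crossing_arcs P = full_diagram M S"
proof -
  define A where "A = full_diagram M S"
  note rng = full_diagram_props(1)[OF H, folded A_def]
  note less = full_diagram_props(2)[OF H, folded A_def]
  note mir = full_diagram_props(3)[OF H, folded A_def]
  note sv = full_diagram_props(4)[OF H, folded A_def]
  note opp = full_diagram_props(5)[OF H, folded A_def]
  have mir': "(- j, - i) \<in> A\<^sup>*" if "(i, j) \<in> A\<^sup>*" for i j
    using mirror_rtrancl[of A] mir that by blast
  have less_or_eq: "i = j \<or> nesting_less i j" if "(i, j) \<in> A\<^sup>*" for i j
    using that by (induction rule: rtrancl_induct) (auto dest: less nesting_less_trans)
  have antisym: False if "(i, j) \<in> A\<^sup>*" "nesting_less j i" for i j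
    using less_or_eq[OF that(1)] that(2) nesting_less_trans nesting_less_irrefl by blast
  have fwd: "(y, z) \<in> A\<^sup>* \<or> (z, y) \<in> A\<^sup>*" if "(x, y) \<in> A\<^sup>*" "(x, z) \<in> A\<^sup>*" for x y z
    using single_valued_confluent[OF sv that] .
  have bwd: "(x, y) \<in> A\<^sup>* \<or> (y, x) \<in> A\<^sup>*" if "(x, z) \<in> A\<^sup>*" "(y, z) \<in> A\<^sup>*" for x y z
    using fwd[OF mir'[OF that(1)] mir'[OF that(2)]] mir'[of "- x" "- y"] mir'[of "- y" "- x"]
    by auto
  define E where "E = {(x, y). x \<in> pm_interval n \<and> y \<in> pm_interval n \<and>
    ((x, y) \<in> A\<^sup>* \<or> (y, x) \<in> A\<^sup>*)}"
  have E_mir: "(- x, - y) \<in> E" if "(x, y) \<in> E" for x y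
    using that mir' unfolding E_def pm_interval_def by auto
  have "trans E"
  proof (rule transI)
    fix x y z assume "(x, y) \<in> E" "(y, z) \<in> E"
    then show "(x, z) \<in> E"
      using fwd[of y x z] bwd[of x y z] rtrancl_trans[of x y A z] rtrancl_trans[of z y A x]
      unfolding E_def by blast
  qed
  then have E: "equiv (pm_interval n) E"
    by (auto simp: equiv_def refl_on_def sym_def E_def)
  define P where "P = pm_interval n // E"
  have part: "partition_on (pm_interval n) P"
    unfolding P_def using partition_on_quotient[OF E] .
  have U: "\<Union>P = pm_interval n" using partition_onD1[OF part] by simp
  have rel: "(x, y) \<in> E" if "B \<in> P" "x \<in> B" "y \<in> B" for B x y
    using quotient_eq_iff[OF E, of B B x y] that unfolding P_def by blast
  have sat: "y \<in> B" if "B \<in> P" "x \<in> B" "(x, y) \<in> E" for B x y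
    using in_quotient_imp_closed[OF E, of B x y] that unfolding P_def by blast
  have arcs: "crossing_arcs P = A"
  proof safe
    fix i j assume "(i, j) \<in> crossing_arcs P"
    then obtain B where B: "B \<in> P" "(i, j) \<in> block_arcs B" unfolding crossing_arcs_def by blast
    note a = block_arcsD[OF B(2)]
    have "(i, j) \<in> A\<^sup>*" using rel[OF B(1) a(1,2)] antisym a(3) unfolding E_def by blast
    moreover have "i \<noteq> j" using a(3) nesting_less_irrefl by blast
    ultimately obtain k where k: "(i, k) \<in> A" "(k, j) \<in> A\<^sup>*" by (metis converse_rtranclE)
    have "k \<in> B" using sat[OF B(1) a(1), of k] k rng[OF k(1)] unfolding E_def by blast
    then have "\<not> nesting_less k j" using a(4) less k by blast
    then show "(i, j) \<in> A" using less_or_eq[OF k(2)] k by blast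
  next
    fix i j assume a: "(i, j) \<in> A"
    obtain B where B: "B \<in> P" "i \<in> B" using rng[OF a] U by blast
    have "j \<in> B" using sat[OF B, of j] a rng[OF a] unfolding E_def by blast
    have "(i, j) \<in> block_arcs B"
    proof (rule block_arcsI[OF B(2) \<open>j \<in> B\<close> less[OF a]])
      fix k assume k: "k \<in> B" "nesting_less i k" "nesting_less k j"
      have "(i, k) \<in> A\<^sup>*" using rel[OF B k(1)] k(2) antisym unfolding E_def by blast
      moreover have "i \<noteq> k" using k(2) nesting_less_irrefl by blast
      ultimately obtain l where "(i, l) \<in> A" "(l, k) \<in> A\<^sup>*" by (metis converse_rtranclE)
      then have "(j, k) \<in> A\<^sup>*" using single_valuedD[OF sv a] by blast
      then show False using k(3) antisym by blast
    qed
    then show "(i, j) \<in> crossing_arcs P" using B unfolding crossing_arcs_def by blast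
  qed
  have mirror_block: "uminus ` B \<in> P" if B: "B \<in> P" for B
  proof -
    obtain x where x: "x \<in> pm_interval n" "B = E `` {x}"
      using B unfolding P_def by (auto elim: quotientE)
    have "uminus ` B = E `` {- x}"
    proof safe
      fix y assume "y \<in> B"
      then show "(- x, - y) \<in> E" using E_mir x by blast
    next
      fix y assume "(- x, y) \<in> E"
      then have "- y \<in> B" using E_mir[of "- x" y] x by auto
      then show "y \<in> uminus ` B" by (metis image_eqI minus_minus)
    qed
    moreover have "- x \<in> pm_interval n" using x unfolding pm_interval_def by auto
    ultimately show ?thesis unfolding P_def by (metis quotientI)
  qed
  have zero: "\<exists>i\<in>B. (i, - i) \<in> A" if B: "B \<in> P" "is_zero_block B" for B
  proof -
    have "B \<subseteq> pm_interval n" "B \<noteq> {}" using U B partition_onD3[OF part] by blast+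
    moreover from this have "finite B" "0 \<notin> B"
      using finite_pm_interval finite_subset unfolding pm_interval_def by blast+
    ultimately obtain i where "i \<in> B" "(i, - i) \<in> block_arcs B"
      using zero_arc B(2) by metis
    then show ?thesis using B arcs unfolding crossing_arcs_def by blast
  qed
  have "B = C" if BC: "B \<in> P" "C \<in> P" "is_zero_block B" "is_zero_block C" for B C
  proof -
    obtain i k where "i \<in> B" "(i, - i) \<in> A" "k \<in> C" "(k, - k) \<in> A"
      using zero[OF BC(1,3)] zero[OF BC(2,4)] by blast
    then have "i \<in> B" "i \<in> C" using opp by blast+
    then show ?thesis using partition_onD2[OF part] BC unfolding disjoint_def by blast
  qed
  moreover have "B \<in> P \<longleftrightarrow> uminus ` B \<in> P" for B
    using mirror_block[of B] mirror_block[of "uminus ` B"] by (auto simp: image_image)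
  ultimately have "set_partition_B n P"
    unfolding set_partition_B_def using part by blast
  then show thesis using that arcs unfolding A_def by blast
qed

section \<open>Openers, closers and nesting arcs\<close>

lemma closers_eq:
  assumes P: "set_partition_B n P"
  shows "closers P = Range (pos_arcs P)"
proof safe
  fix j assume "j \<in> closers P"
  then obtain B i where B: "0 < j" "B \<in> P" "j \<in> B" "i \<in> B" "nesting_less i j"
    unfolding closers_def by blast
  have "(i, j) \<in> (block_arcs B)\<^sup>*" "i \<noteq> j"
    using block_arcs_connect[OF set_partition_B_D(4)[OF P B(2)]] B nesting_less_irrefl by blast+
  then obtain k where k: "(k, j) \<in> block_arcs B" by (metis rtranclE)
  then have "0 < k" using block_arcsD(3)[OF k] B(1) unfolding nesting_less_def by auto
  then show "j \<in> Range (pos_arcs P)"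
    using k B unfolding pos_arcs_def crossing_arcs_def by blast
next
  fix i j assume "(i, j) \<in> pos_arcs P"
  then obtain B where B: "B \<in> P" "0 < j" and a: "(i, j) \<in> block_arcs B"
    unfolding pos_arcs_def crossing_arcs_def by blast
  show "j \<in> closers P"
    using block_arcsD(1-3)[OF a] B unfolding closers_def by blast
qed

lemma openers_eq:
  assumes P: "set_partition_B n P"
  shows "openers P = Domain (pos_arcs P) \<union> Domain (mid_arcs P)"
proof safe
  fix i assume i: "i \<in> openers P" "i \<notin> Domain (mid_arcs P)"
  then obtain B j where B: "0 < i" "B \<in> P" "i \<in> B" "j \<in> B" "nesting_less i j"
    unfolding openers_def by blast
  have "(i, j) \<in> (block_arcs B)\<^sup>*" "i \<noteq> j"
    using block_arcs_connect[OF set_partition_B_D(4)[OF P B(2)]] B nesting_less_irrefl by blast+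
  then obtain k where k: "(i, k) \<in> block_arcs B" by (metis converse_rtranclE)
  then have a: "(i, k) \<in> crossing_arcs P" using B unfolding crossing_arcs_def by blast
  have "k \<noteq> 0" using block_arcsD(2)[OF k] set_partition_B_D(5)[OF P B(2)] by blast
  moreover have "\<not> k < 0"
  proof
    assume "k < 0"
    then have "(i, - k) \<in> mid_arcs P" using a B unfolding mid_arcs_def by simp
    then show False using i by blast
  qed
  ultimately show "i \<in> Domain (pos_arcs P)"
    using a B unfolding pos_arcs_def by (intro DomainI[of i k]) auto
next
  fix i j assume "(i, j) \<in> pos_arcs P"
  then obtain B where B: "B \<in> P" "0 < i" and a: "(i, j) \<in> block_arcs B"
    unfolding pos_arcs_def crossing_arcs_def by blast
  show "i \<in> openers P"
    using block_arcsD(1-3)[OF a] B unfolding openers_def by blast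
next
  fix i j assume "(i, j) \<in> mid_arcs P"
  then obtain B where B: "B \<in> P" "0 < i" and a: "(i, - j) \<in> block_arcs B"
    unfolding mid_arcs_def crossing_arcs_def by blast
  show "i \<in> openers P"
    using block_arcsD(1-3)[OF a] B unfolding openers_def by blast
qed

text \<open>Inserting \<open>0\<close> into the zero block subdivides its middle arc \<open>(i, - i)\<close> and changes nothing else.\<close>

lemma nesting_arcs_eq:
  assumes P: "set_partition_B n P"
  shows "(i, j) \<in> nesting_arcs P \<longleftrightarrow>
    ((i, j) \<in> crossing_arcs P \<and> i \<noteq> - j) \<or> (j = 0 \<and> (i, - i) \<in> crossing_arcs P) \<or>
    (i = 0 \<and> (- j, j) \<in> crossing_arcs P)"
proof -
  have zero: "(i, j) \<in> block_arcs (insert 0 B) \<longleftrightarrow>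
      ((i, j) \<in> block_arcs B \<and> i \<noteq> - j) \<or> (j = 0 \<and> (i, - i) \<in> block_arcs B) \<or>
      (i = 0 \<and> (- j, j) \<in> block_arcs B)"
    if B: "B \<in> P" "is_zero_block B" for B
  proof -
    obtain m where m: "0 < m" "(m, - m) \<in> block_arcs B"
      using zero_arc set_partition_B_D(4-6)[OF P B(1)] B(2) by blast
    note a = block_arcsD[OF m(2)]
    have op: "- k \<in> B" if "k \<in> B" for k
      using is_zero_block_iff_opposite[OF P B(1) that] B(2) by blast
    have nz: "k \<noteq> 0" if "k \<in> B" for k using that set_partition_B_D(5)[OF P B(1)] by blast
    have max: "k \<le> m" if "k \<in> B" for k
    proof (rule ccontr)
      assume "\<not> k \<le> m"
      then show False using a(4)[OF that] m unfolding nesting_less_def by auto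
    qed
    have opp: "(k, - k) \<in> block_arcs B \<longleftrightarrow> k = m" for k
      using m opposite_arc_unique[OF P, of k m] B unfolding crossing_arcs_def by blast
    \<comment> \<open>no element of the block lies strictly between "m" and "- m"\<close>
    have outer: "k = m \<or> k = - m \<or> nesting_less k m \<or> nesting_less (- m) k" if "k \<in> B" for k
      using max[OF that] max[OF op[OF that]] nz[OF that] m unfolding nesting_less_def by arith
    have m0: "nesting_less m 0" "nesting_less 0 (- m)" using m unfolding nesting_less_def by auto
    note lin = nesting_less_trans nesting_less_irrefl
    have from0: "(0, j) \<in> block_arcs (insert 0 B) \<longleftrightarrow> j = - m"
    proof
      assume j: "(0, j) \<in> block_arcs (insert 0 B)"
      note b = block_arcsD[OF j]
      have "j \<in> B" using b(2,3) lin by blast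
      then show "j = - m" using outer[of j] b(3) b(4)[of "- m"] m0 op[OF a(1)] lin by blast
    next
      assume "j = - m"
      then show "(0, j) \<in> block_arcs (insert 0 B)"
        using outer m0 op[OF a(1)] lin by (intro block_arcsI) blast+
    qed
    have to0: "(i, 0) \<in> block_arcs (insert 0 B) \<longleftrightarrow> i = m"
    proof
      assume j: "(i, 0) \<in> block_arcs (insert 0 B)"
      note b = block_arcsD[OF j]
      have "i \<in> B" using b(1,3) lin by blast
      then show "i = m" using outer[of i] b(3) b(4)[of m] m0 a(1) lin by blast
    next
      assume "i = m"
      then show "(i, 0) \<in> block_arcs (insert 0 B)"
        using outer m0 a(1) lin by (intro block_arcsI) blast+
    qed
    have rest: "(i, j) \<in> block_arcs (insert 0 B) \<longleftrightarrow> (i, j) \<in> block_arcs B \<and> i \<noteq> - j"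
      if "i \<noteq> 0" "j \<noteq> 0"
    proof
      assume b: "(i, j) \<in> block_arcs (insert 0 B)"
      then have "(i, j) \<in> block_arcs B"
        using that block_arcsD[OF b] by (intro block_arcsI) blast+
      moreover have "i \<noteq> - j"
      proof
        assume "i = - j"
        then have "nesting_less i 0" "nesting_less 0 j"
          using block_arcsD(3)[OF b] that unfolding nesting_less_def by auto
        then show False using block_arcsD(4)[OF b] by blast
      qed
      ultimately show "(i, j) \<in> block_arcs B \<and> i \<noteq> - j" by blast
    next
      assume b: "(i, j) \<in> block_arcs B \<and> i \<noteq> - j"
      then have b': "(i, j) \<in> block_arcs B" by blast
      note c = block_arcsD[OF b']
      have "\<not> (nesting_less i 0 \<and> nesting_less 0 j)"
        using c(3) c(4)[OF a(1)] c(4)[OF op[OF a(1)]] outer[OF c(1)] outer[OF c(2)] b m0 lin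
        by (metis minus_minus)
      then show "(i, j) \<in> block_arcs (insert 0 B)"
        using c by (intro block_arcsI) blast+
    qed
    show ?thesis
    proof (cases "i = 0 \<or> j = 0")
      case True
      have "(0, j) \<notin> block_arcs B" "(i, 0) \<notin> block_arcs B" for i j
        using block_arcsD(1,2) nz by blast+
      moreover have "(- j, j) \<in> block_arcs B \<longleftrightarrow> j = - m" for j using opp[of "- j"] by auto
      ultimately show ?thesis using True opp from0 to0 m by auto
    next
      case False
      then show ?thesis using rest by blast
    qed
  qed
  have nonzero: "(k, - k) \<notin> block_arcs B" if "B \<in> P" "\<not> is_zero_block B" for B k
    using is_zero_block_iff_opposite[OF P that(1)] that(2) block_arcsD(1,2) by blast
  show ?thesis
  proof
    assume "(i, j) \<in> nesting_arcs P"
    then obtain B where B: "B \<in> P" "(i, j) \<in> block_arcs (if is_zero_block B then insert 0 B else B)"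
      unfolding nesting_arcs_def by blast
    show "((i, j) \<in> crossing_arcs P \<and> i \<noteq> - j) \<or> (j = 0 \<and> (i, - i) \<in> crossing_arcs P) \<or>
        (i = 0 \<and> (- j, j) \<in> crossing_arcs P)"
    proof (cases "is_zero_block B")
      case True
      then show ?thesis using zero[OF B(1) True] B unfolding crossing_arcs_def by auto
    next
      case False
      then have "(i, j) \<in> crossing_arcs P \<and> i \<noteq> - j"
        using B nonzero[OF B(1) False, of i] unfolding crossing_arcs_def by auto
      then show ?thesis by blast
    qed
  next
    have lift: "(i, j) \<in> nesting_arcs P"
      if "B \<in> P" "is_zero_block B" "(i, j) \<in> block_arcs (insert 0 B)" for B
      using that unfolding nesting_arcs_def by force
    assume "((i, j) \<in> crossing_arcs P \<and> i \<noteq> - j) \<or> (j = 0 \<and> (i, - i) \<in> crossing_arcs P) \<or>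
        (i = 0 \<and> (- j, j) \<in> crossing_arcs P)"
    then obtain B where B: "B \<in> P" "((i, j) \<in> block_arcs B \<and> i \<noteq> - j) \<or>
        (j = 0 \<and> (i, - i) \<in> block_arcs B) \<or> (i = 0 \<and> (- j, j) \<in> block_arcs B)"
      unfolding crossing_arcs_def by blast
    show "(i, j) \<in> nesting_arcs P"
    proof (cases "is_zero_block B")
      case True
      then show ?thesis using zero[OF B(1) True] lift B by blast
    next
      case False
      then have "(i, j) \<in> block_arcs B"
        using B nonzero[OF B(1) False, of i] nonzero[OF B(1) False, of "- j"] by auto
      then show ?thesis using B(1) False unfolding nesting_arcs_def by force
    qed
  qed
qed

section \<open>Crossings and nestings on the positive half\<close>

text \<open>Reading off the crossings on the positive half is possible because a crossing that involves an arc
between negative elements is the mirror image of one that involves an arc between positive elements.  Two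
of the latter arcs cross as usual.  An arc \<open>(i, j)\<close> between positive elements crosses an arc from \<open>r\<close> to a
negative element when \<open>i < r < j\<close>.  Two arcs from positive to negative elements cross when their
openers and the absolute values of their closers come in the same order.\<close>

lemma non_crossing_iff_half:
  assumes P: "set_partition_B n P"
  defines "M \<equiv> pos_arcs P" and "S \<equiv> mid_arcs P"
  shows "non_crossing P \<longleftrightarrow>
    (\<forall>(i, j)\<in>M. \<forall>(i', j')\<in>M. \<not> (i < i' \<and> i' < j \<and> j < j')) \<and>
    (\<forall>(i, j)\<in>M. \<forall>r\<in>Domain S. \<not> (i < r \<and> r < j)) \<and> mid_noncrossing S"
    (is "_ \<longleftrightarrow> ?half")
proof
  have H: "half_diagram n M S"
    unfolding M_def S_def by (rule half_diagram_of_partition[OF P])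
  have A: "(x, y) \<in> crossing_arcs P \<longleftrightarrow>
      (0 < x \<and> 0 < y \<and> (x, y) \<in> M) \<or> (x < 0 \<and> y < 0 \<and> (- y, - x) \<in> M) \<or>
      (0 < x \<and> y < 0 \<and> (x, - y) \<in> S)" for x y
    using crossing_arcs_eq_full_diagram[OF P] full_diagram_iff[OF H] unfolding M_def S_def by simp
  have S: "(j, i) \<in> S" if "(i, j) \<in> S" for i j
    using H that unfolding half_diagram_def by (meson symD)
  note rng = half_diagram_pos[OF H]
  {
    assume half: ?half
    have MM: "\<not> (i < i' \<and> i' < j \<and> j < j')" if "(i, j) \<in> M" "(i', j') \<in> M" for i j i' j'
      using half that by blast
    have MS: "\<not> (i < r \<and> r < j)" if "(i, j) \<in> M" "(r, s) \<in> S \<or> (s, r) \<in> S" for i j r s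
      using half that S by blast
    have SS: "\<not> (i \<le> j \<and> i' \<le> j' \<and> i < i' \<and> j < j')" if "(i, j) \<in> S" "(i', j') \<in> S" for i j i' j'
      using half that unfolding mid_noncrossing_def by blast
    \<comment> \<open>the endpoints in crossing order: for an arc between negative elements this exchanges opener and closer\<close>
    have sorted: "(0 < a \<and> 0 < b \<and> (a, b) \<in> M \<and> x = a \<and> y = b) \<or>
        (a < 0 \<and> b < 0 \<and> (- a, - b) \<in> M) \<or> (0 < a \<and> b < 0 \<and> (a, - b) \<in> S \<and> x = a \<and> y = b)"
      if xy: "(x, y) \<in> crossing_arcs P" and e: "endpoints (x, y) = {a, b}"
        and o: "crossing_less a b" for x y a b
    proof -
      have ab: "(a = x \<and> b = y) \<or> (a = y \<and> b = x)"
        using e unfolding endpoints_def by (auto simp: doubleton_eq_iff)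
      consider "0 < x" "0 < y" "(x, y) \<in> M" "x < y" | "x < 0" "y < 0" "(- y, - x) \<in> M" "x < y"
        | "0 < x" "y < 0" "(x, - y) \<in> S" using xy A rng(1)[of x y] rng(1)[of "- y" "- x"] by force
      then show ?thesis
      proof cases
        case 1
        then have "a = x \<and> b = y" using ab o unfolding crossing_less_def by auto
        then show ?thesis using 1 by blast
      next
        case 2
        then have "a = y \<and> b = x" using ab o unfolding crossing_less_def by auto
        then show ?thesis using 2 by blast
      next
        case 3
        then have "a = x \<and> b = y" using ab o unfolding crossing_less_def by auto
        then show ?thesis using 3 by blast
      qed
    qed
    have False
      if xy: "(x, y) \<in> crossing_arcs P" "(x', y') \<in> crossing_arcs P"
        and e: "endpoints (x, y) = {a, b}" "endpoints (x', y') = {a', b'}"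
        and o: "crossing_less a a'" "crossing_less a' b" "crossing_less b b'"
        and n: "\<not> (0 < x \<and> y < 0 \<and> 0 < x' \<and> y' < 0 \<and>
          (closer_smaller (x, y) \<or> closer_smaller (x', y')))"
      for x y x' y' a b a' b'
    proof -
      have "crossing_less a b" "crossing_less a' b'"
        using o unfolding crossing_less_def by arith+
      note s = sorted[OF xy(1) e(1) this(1)] sorted[OF xy(2) e(2) this(2)]
      from s(1) consider
          (pos) "0 < a" "0 < b" "(a, b) \<in> M" | (neg) "a < 0" "b < 0" "(- a, - b) \<in> M"
        | (mid) "0 < a" "b < 0" "(a, - b) \<in> S" "x = a" "y = b" by blast
      note c = this
      from s(2) consider
          (pos') "0 < a'" "0 < b'" "(a', b') \<in> M" | (neg') "a' < 0" "b' < 0" "(- a', - b') \<in> M"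
        | (mid') "0 < a'" "b' < 0" "(a', - b') \<in> S" "x' = a'" "y' = b'" by blast
      note c' = this
      show False
      proof (cases rule: c)
        case pos
        show False
        proof (cases rule: c')
          case pos'
          then show False using o pos MM[OF pos(3) pos'(3)] unfolding crossing_less_def by linarith
        next
          case neg'
          then show False using o pos unfolding crossing_less_def by linarith
        next
          case mid'
          then show False
            using o pos MS[OF pos(3) disjI1[OF mid'(3)]] unfolding crossing_less_def by linarith
        qed
      next
        case neg
        show False
        proof (cases rule: c')
          case neg'
          then show False using o neg MM[OF neg(3) neg'(3)] unfolding crossing_less_def by linarith
        qed (use o neg in \<open>unfold crossing_less_def, linarith+\<close>)
      next
        case mid
        show False
        proof (cases rule: c')
          case pos'
          then show False using o mid unfolding crossing_less_def by linarith
        next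
          case neg'
          then show False
            using o mid MS[OF neg'(3) disjI2[OF mid(3)]] unfolding crossing_less_def by linarith
        next
          case mid'
          then have "x \<le> - y" "x' \<le> - y'"
            using n mid unfolding closer_smaller_def abs_less_def by auto
          then show False
            using o mid mid' SS[OF mid(3) mid'(3)] unfolding crossing_less_def by linarith
        qed
      qed
    qed
    then show "non_crossing P"
      unfolding non_crossing_def crossings_def split_paired_Ex fst_conv snd_conv by blast
  }
  {
    assume nc: "non_crossing P"
    have no: False
      if "(x, y) \<in> crossing_arcs P" "(x', y') \<in> crossing_arcs P"
        "crossing_less x x'" "crossing_less x' y" "crossing_less y y'"
        "\<not> (0 < x \<and> y < 0 \<and> 0 < x' \<and> y' < 0 \<and>
          (closer_smaller (x, y) \<or> closer_smaller (x', y')))"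
      for x y x' y'
    proof -
      have "endpoints (x, y) = {x, y}" "endpoints (x', y') = {x', y'}"
        unfolding endpoints_def by simp_all
      then have ex: "\<exists>a b a' b'. endpoints (x, y) = {a, b} \<and> endpoints (x', y') = {a', b'} \<and>
          crossing_less a a' \<and> crossing_less a' b \<and> crossing_less b b'"
        using that(3-5) by blast
      have "{(x, y), (x', y')} \<in> crossings P"
        unfolding crossings_def mem_Collect_eq
        by (intro exI[of _ "(x, y)"] exI[of _ "(x', y')"] conjI refl that(1,2) ex)
          (use that(6) in simp)
      then show False using nc unfolding non_crossing_def by blast
    qed
    have "\<not> (i < i' \<and> i' < j \<and> j < j')" if "(i, j) \<in> M" "(i', j') \<in> M" for i j i' j'
      using no[of i j i' j'] rng(1)[OF that(1)] rng(1)[OF that(2)] that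
      unfolding A crossing_less_def by auto
    moreover have "\<not> (i < r \<and> r < j)" if "(i, j) \<in> M" "(r, s) \<in> S" for i j r s
      using no[of i j r "- s"] rng(1)[OF that(1)] rng(2)[OF that(2)] that
      unfolding A crossing_less_def by auto
    moreover have "\<not> (i \<le> j \<and> i' \<le> j' \<and> i < i' \<and> j < j')" if "(i, j) \<in> S" "(i', j') \<in> S" for i j i' j'
      using no[of i "- j" i' "- j'"] rng(2)[OF that(1)] rng(2)[OF that(2)] that
      unfolding A crossing_less_def closer_smaller_def abs_less_def by auto
    ultimately show ?half unfolding mid_noncrossing_def by blast
  }
qed

text \<open>An arc \<open>(i, j)\<close> between positive elements lies inside every arc that starts before \<open>i\<close> and leaves the positive
elements, so no opener of the latter kind may precede \<open>i\<close>.  The nestings among the arcs that leave the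
positive elements or \<open>0\<close> are governed by \<open>mid_nonnesting\<close>.  A nesting that involves an arc between
negative elements is the mirror image of one that involves an arc between positive elements.\<close>

lemma non_nesting_iff_half:
  assumes P: "set_partition_B n P"
  defines "M \<equiv> pos_arcs P" and "S \<equiv> mid_arcs P"
  shows "non_nesting P \<longleftrightarrow>
    (\<forall>(i, j)\<in>M. \<forall>(i', j')\<in>M. \<not> (i < i' \<and> j' < j)) \<and>
    (\<forall>(i, j)\<in>M. \<forall>r\<in>Domain S. \<not> r < i) \<and> mid_nonnesting S"
    (is "_ \<longleftrightarrow> ?half")
proof
  have H: "half_diagram n M S"
    unfolding M_def S_def by (rule half_diagram_of_partition[OF P])
  note rng = half_diagram_pos[OF H]
  have A': "(x, y) \<in> crossing_arcs P \<longleftrightarrow>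
      (0 < x \<and> 0 < y \<and> (x, y) \<in> M) \<or> (x < 0 \<and> y < 0 \<and> (- y, - x) \<in> M) \<or>
      (0 < x \<and> y < 0 \<and> (x, - y) \<in> S)" for x y
    using crossing_arcs_eq_full_diagram[OF P] full_diagram_iff[OF H] unfolding M_def S_def by simp
  have opp: "(x, - x) \<in> crossing_arcs P \<longleftrightarrow> 0 < x \<and> (x, x) \<in> S" for x
    unfolding A' by auto
  have A: "(x, y) \<in> nesting_arcs P \<longleftrightarrow>
      (0 < x \<and> 0 < y \<and> (x, y) \<in> M) \<or> (x < 0 \<and> y < 0 \<and> (- y, - x) \<in> M) \<or>
      (0 < x \<and> y < 0 \<and> x \<noteq> - y \<and> (x, - y) \<in> S) \<or>
      (0 < x \<and> y = 0 \<and> (x, x) \<in> S) \<or> (x = 0 \<and> y < 0 \<and> (- y, - y) \<in> S)" for x y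
    unfolding nesting_arcs_eq[OF P, of x y] opp opp[of "- y", simplified] A' by auto
  have S: "(j, i) \<in> S" if "(i, j) \<in> S" for i j
    using H that unfolding half_diagram_def by (meson symD)
  {
    assume half: ?half
    have MM: "\<not> (i < i' \<and> j' < j)" if "(i, j) \<in> M" "(i', j') \<in> M" for i j i' j'
      using half that by blast
    have MS: "\<not> r < i" if "(i, j) \<in> M" "(r, s) \<in> S \<or> (s, r) \<in> S" for i j r s
      using half that S by blast
    have SS: "\<not> (i < j \<and> i' \<le> j' \<and> i < i' \<and> (i' = j' \<or> j < j'))"
      if "(i, j) \<in> S" "(i', j') \<in> S" for i j i' j'
      using half that unfolding mid_nonnesting_def by blast
    have False
      if xy: "(x, y) \<in> nesting_arcs P" "(x', y') \<in> nesting_arcs P"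
        and e: "endpoints (x, y) = {a, b}" "endpoints (x', y') = {a', b'}"
        and o: "nesting_less a a'" "nesting_less a' b'" "nesting_less b' b"
        and n: "\<not> (0 \<le> x \<and> y \<le> 0 \<and> 0 \<le> x' \<and> y' \<le> 0 \<and>
          (closer_smaller (x, y) \<or> closer_smaller (x', y')))"
      for x y x' y' a b a' b'
    proof -
      have less: "nesting_less p q" if "(p, q) \<in> nesting_arcs P" for p q
        using that rng(1)[of p q] rng(1)[of "- q" "- p"] unfolding A nesting_less_def by auto
      have "(a = x \<and> b = y) \<or> (a = y \<and> b = x)" "(a' = x' \<and> b' = y') \<or> (a' = y' \<and> b' = x')"
        using e unfolding endpoints_def by (auto simp: doubleton_eq_iff)
      then have o': "nesting_less x x'" "nesting_less y' y"
        using o less[OF xy(1)] less[OF xy(2)] nesting_less_trans nesting_less_irrefl by blast+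
      have o'': "(0 < x' \<and> 0 < x \<and> x < x') \<or> (x' = 0 \<and> 0 < x) \<or> (x' < 0 \<and> (0 \<le> x \<or> x < x'))"
        "(0 < y \<and> 0 < y' \<and> y' < y) \<or> (y = 0 \<and> 0 < y') \<or> (y < 0 \<and> (0 \<le> y' \<or> y' < y))"
        using o' unfolding nesting_less_def by arith+
      consider
          (pos) "0 < x" "0 < y" "(x, y) \<in> M" | (neg) "x < 0" "y < 0" "(- y, - x) \<in> M"
        | (mid) "0 < x" "y < 0" "x \<noteq> - y" "(x, - y) \<in> S"
        | (to0) "0 < x" "y = 0" "(x, x) \<in> S" | (from0) "x = 0" "y < 0" "(- y, - y) \<in> S"
        using xy(1) unfolding A by blast
      note c = this
      consider
          (pos') "0 < x'" "0 < y'" "(x', y') \<in> M" | (neg') "x' < 0" "y' < 0" "(- y', - x') \<in> M"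
        | (mid') "0 < x'" "y' < 0" "x' \<noteq> - y'" "(x', - y') \<in> S"
        | (to0') "0 < x'" "y' = 0" "(x', x') \<in> S" | (from0') "x' = 0" "y' < 0" "(- y', - y') \<in> S"
        using xy(2) unfolding A by blast
      note c' = this
      show False
      proof (cases rule: c')
        case pos'
        show False
        proof (cases rule: c)
          case pos
          then show False using o'' pos' MM[OF pos(3) pos'(3)] by linarith
        next
          case mid
          then show False using o'' pos' MS[OF pos'(3) disjI1[OF mid(4)]] by linarith
        next
          case to0
          then show False using o'' pos' MS[OF pos'(3) disjI1[OF to0(3)]] by linarith
        qed (use o'' pos' in linarith)+
      next
        case neg'
        show False
        proof (cases rule: c)
          case neg
          then show False using o'' neg' MM[OF neg(3) neg'(3)] by linarith
        next
          case mid
          then show False using o'' neg' MS[OF neg'(3) disjI2[OF mid(4)]] by linarith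
        next
          case from0
          then show False using o'' neg' MS[OF neg'(3) disjI1[OF from0(3)]] by linarith
        qed (use o'' neg' in linarith)+
      next
        case mid'
        show False
        proof (cases rule: c)
          case mid
          then have "x \<le> - y" "x' \<le> - y'"
            using n mid' unfolding closer_smaller_def abs_less_def by auto
          then show False using o'' mid mid' SS[OF mid(4) mid'(4)] by linarith
        qed (use o'' mid' in linarith)+
      next
        case to0'
        show False
        proof (cases rule: c)
          case mid
          then have "x \<le> - y"
            using n to0' unfolding closer_smaller_def abs_less_def by auto
          then show False using o'' mid to0' SS[OF mid(4) to0'(3)] by linarith
        qed (use o'' to0' in linarith)+
      next
        case from0'
        then have "closer_smaller (x', y')" unfolding closer_smaller_def abs_less_def by auto
        show False
        proof (cases rule: c)
          case mid
          then show False using n from0' \<open>closer_smaller (x', y')\<close> by auto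
        qed (use o'' from0' in linarith)+
      qed
    qed
    then show "non_nesting P"
      unfolding non_nesting_def nestings_def split_paired_Ex fst_conv snd_conv by blast
  }
  {
    assume nn: "non_nesting P"
    have no: False
      if "(x, y) \<in> nesting_arcs P" "(x', y') \<in> nesting_arcs P"
        "nesting_less x x'" "nesting_less x' y'" "nesting_less y' y"
        "\<not> (0 \<le> x \<and> y \<le> 0 \<and> 0 \<le> x' \<and> y' \<le> 0 \<and>
          (closer_smaller (x, y) \<or> closer_smaller (x', y')))"
      for x y x' y'
    proof -
      have "endpoints (x, y) = {x, y}" "endpoints (x', y') = {x', y'}"
        unfolding endpoints_def by simp_all
      then have ex: "\<exists>a b a' b'. endpoints (x, y) = {a, b} \<and> endpoints (x', y') = {a', b'} \<and>
          nesting_less a a' \<and> nesting_less a' b' \<and> nesting_less b' b"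
        using that(3-5) by blast
      have "{(x, y), (x', y')} \<in> nestings P"
        unfolding nestings_def mem_Collect_eq
        by (intro exI[of _ "(x, y)"] exI[of _ "(x', y')"] conjI refl that(1,2) ex)
          (use that(6) in simp)
      then show False using nn unfolding non_nesting_def by blast
    qed
    have "\<not> (i < i' \<and> j' < j)" if "(i, j) \<in> M" "(i', j') \<in> M" for i j i' j'
      using no[of i j i' j'] rng(1)[OF that(1)] rng(1)[OF that(2)] that
      unfolding A nesting_less_def by auto
    moreover have "\<not> r < i" if "(i, j) \<in> M" "(r, s) \<in> S" for i j r s
      using no[of r "- s" i j] no[of r 0 i j] rng(1)[OF that(1)] rng(2)[OF that(2)] that
      unfolding A nesting_less_def by auto
    moreover have "\<not> (i < j \<and> i' \<le> j' \<and> i < i' \<and> (i' = j' \<or> j < j'))"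
      if "(i, j) \<in> S" "(i', j') \<in> S" for i j i' j'
    proof (cases "i' = j'")
      case True
      then show ?thesis
        using no[of i "- j" i' 0] rng(2)[OF that(1)] rng(2)[OF that(2)] that
        unfolding A nesting_less_def closer_smaller_def abs_less_def by auto
    next
      case False
      then show ?thesis
        using no[of i "- j" i' "- j'"] rng(2)[OF that(1)] rng(2)[OF that(2)] that
        unfolding A nesting_less_def closer_smaller_def abs_less_def by auto
    qed
    ultimately show ?half unfolding mid_nonnesting_def by blast
  }
qed

text \<open>Let \<open>(i, j)\<close> be an arc between positive elements and \<open>r\<close> an opener with \<open>i < r < j\<close>.  The arc that leaves
\<open>r\<close> avoids a crossing precisely when it returns before \<open>j\<close>, that is, when \<open>r\<close> is matched to an earlier
closer.  This is greediness in favour of the last free opener.\<close>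

lemma non_crossing_iff_greedy:
  assumes P: "set_partition_B n P"
  shows "non_crossing P \<longleftrightarrow>
    greedy id (openers P) (pos_arcs P) \<and> mid_noncrossing (mid_arcs P)"
proof -
  let ?M = "pos_arcs P" and ?S = "mid_arcs P"
  have H: "half_diagram n ?M ?S" by (rule half_diagram_of_partition[OF P])
  then have M: "single_valued ?M" "Domain ?M \<inter> Domain ?S = {}"
    unfolding half_diagram_def increasing_matching_def by blast+
  have inj: "a = b" if "(a, j) \<in> ?M" "(b, j) \<in> ?M" for a b j
    using H that unfolding half_diagram_def increasing_matching_def single_valued_def by blast
  have "greedy id (openers P) ?M \<longleftrightarrow>
      (\<forall>(i, j)\<in>?M. \<forall>(i', j')\<in>?M. \<not> (i < i' \<and> i' < j \<and> j < j')) \<and>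
      (\<forall>(i, j)\<in>?M. \<forall>r\<in>Domain ?S. \<not> (i < r \<and> r < j))" (is "_ \<longleftrightarrow> ?A \<and> ?B")
  proof
    assume g: "greedy id (openers P) ?M"
    have gr: "\<exists>j'\<le>j. (r, j') \<in> ?M"
      if "(i, j) \<in> ?M" "r \<in> Domain ?M \<union> Domain ?S" "i < r" "r < j" for i j r
      using g that openers_eq[OF P] unfolding greedy_def by fastforce
    have "\<not> (i < i' \<and> i' < j \<and> j < j')" if ij: "(i, j) \<in> ?M" "(i', j') \<in> ?M" for i j i' j'
    proof
      assume less: "i < i' \<and> i' < j \<and> j < j'"
      then obtain k where "k \<le> j" "(i', k) \<in> ?M" using gr[OF ij(1), of i'] ij(2) by blast
      then show False using single_valuedD[OF M(1) ij(2)] less by force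
    qed
    moreover have "\<not> (i < r \<and> r < j)" if "(i, j) \<in> ?M" "r \<in> Domain ?S" for i j r
      using gr[OF that(1), of r] that(2) M(2) by blast
    ultimately show "?A \<and> ?B" by blast
  next
    assume half: "?A \<and> ?B"
    have "\<exists>j'\<le>j. (r, j') \<in> ?M" if "(i, j) \<in> ?M" "r \<in> openers P" "i < r" "r < j" for i j r
    proof -
      have "r \<in> Domain ?M" using that half openers_eq[OF P] by fast
      then obtain j' where j': "(r, j') \<in> ?M" by blast
      then have "\<not> j < j'" using half that by blast
      then show ?thesis using j' by (intro exI[of _ j']) simp
    qed
    then show "greedy id (openers P) ?M" unfolding greedy_def by auto
  qed
  then show ?thesis using non_crossing_iff_half[OF P] by blast
qed

text \<open>An opener \<open>r < i\<close> leads to no nesting around an arc \<open>(i, j)\<close> between positive elements precisely when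
\<open>r\<close> is matched to a closer before \<open>j\<close>.  This is greediness in favour of the first free opener.\<close>

lemma non_nesting_iff_greedy:
  assumes P: "set_partition_B n P"
  shows "non_nesting P \<longleftrightarrow>
    greedy uminus (openers P) (pos_arcs P) \<and> mid_nonnesting (mid_arcs P)"
proof -
  let ?M = "pos_arcs P" and ?S = "mid_arcs P"
  have H: "half_diagram n ?M ?S" by (rule half_diagram_of_partition[OF P])
  then have M: "single_valued ?M" "Domain ?M \<inter> Domain ?S = {}"
    unfolding half_diagram_def increasing_matching_def by blast+
  have less: "i < j" if "(i, j) \<in> ?M" for i j
    using half_diagram_pos(1)[OF H that] by blast
  have "greedy uminus (openers P) ?M \<longleftrightarrow>
      (\<forall>(i, j)\<in>?M. \<forall>(i', j')\<in>?M. \<not> (i < i' \<and> j' < j)) \<and>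
      (\<forall>(i, j)\<in>?M. \<forall>r\<in>Domain ?S. \<not> r < i)" (is "_ \<longleftrightarrow> ?A \<and> ?B")
  proof
    assume g: "greedy uminus (openers P) ?M"
    have gr: "\<exists>j'\<le>j. (r, j') \<in> ?M"
      if "(i, j) \<in> ?M" "r \<in> Domain ?M \<union> Domain ?S" "r < i" for i j r
      using g that openers_eq[OF P] less[OF that(1)] unfolding greedy_def by fastforce
    have "\<not> (i < i' \<and> j' < j)" if ij: "(i, j) \<in> ?M" "(i', j') \<in> ?M" for i j i' j'
    proof
      assume less: "i < i' \<and> j' < j"
      then obtain k where "k \<le> j'" "(i, k) \<in> ?M" using gr[OF ij(2), of i] ij(1) by blast
      then show False using single_valuedD[OF M(1) ij(1)] less by force
    qed
    moreover have "\<not> r < i" if "(i, j) \<in> ?M" "r \<in> Domain ?S" for i j r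
      using gr[OF that(1), of r] that(2) M(2) by blast
    ultimately show "?A \<and> ?B" by blast
  next
    assume half: "?A \<and> ?B"
    have "\<exists>j'\<le>j. (r, j') \<in> ?M" if "(i, j) \<in> ?M" "r \<in> openers P" "r < i" for i j r
    proof -
      have "r \<in> Domain ?M" using that half openers_eq[OF P] by fast
      then obtain j' where j': "(r, j') \<in> ?M" by blast
      then have "\<not> j < j'" using half that by blast
      then show ?thesis using j' by (intro exI[of _ j']) simp
    qed
    then show "greedy uminus (openers P) ?M" unfolding greedy_def by auto
  qed
  then show ?thesis using non_nesting_iff_half[OF P] by blast
qed

section \<open>Existence and uniqueness\<close>

text \<open>The common part of the two assertions: \<open>w\<close> fixes the greedy matching of the closers, and \<open>\<Psi>\<close> singles
out one involution on the openers that the matching leaves over.\<close>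

lemma ex1_partition:
  fixes w :: "int \<Rightarrow> int"
  assumes conf: "opener_closer_configuration n X Y" and w: "inj w"
    and char: "\<And>P. set_partition_B n P \<Longrightarrow>
      \<Phi> P \<longleftrightarrow> greedy w (openers P) (pos_arcs P) \<and> \<Psi> (mid_arcs P)"
    and mid: "\<And>R. finite R \<Longrightarrow> \<exists>!S. involution_on R S \<and> fixes_at_most_one S \<and> \<Psi> S"
  shows "\<exists>!P. set_partition_B n P \<and> \<Phi> P \<and> openers P = X \<and> closers P = Y"
proof -
  have X: "X \<subseteq> {1..int n}" and Y: "Y \<subseteq> {1..int n}"
    and count: "\<And>k. k < n \<Longrightarrow> card (Y \<inter> {1..int k + 1}) \<le> card (X \<inter> {1..int k})"
    using conf unfolding opener_closer_configuration_def by auto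
  have fin: "finite X" "finite Y" using X Y finite_subset by blast+
  have "card (Y \<inter> {..c}) \<le> card (X \<inter> {..<c})" if "c \<in> Y" for c
  proof -
    have c: "1 \<le> c" "c \<le> int n" using Y that by auto
    \<comment> \<open>the hypothesis on initial segments is used at "k = c - 1"\<close>
    then have "Y \<inter> {..c} = Y \<inter> {1..int (nat (c - 1)) + 1}"
      "X \<inter> {..<c} = X \<inter> {1..int (nat (c - 1))}" using X Y by auto
    then show ?thesis using count[of "nat (c - 1)"] c by auto
  qed
  then obtain M where M: "increasing_matching M" "greedy w X M" "Domain M \<subseteq> X" "Range M = Y"
    using greedy_matching_exists[OF fin(2,1), of w] by blast
  define R where "R = X - Domain M"
  have "finite R" using fin unfolding R_def by simp
  then obtain S where S: "involution_on R S" "fixes_at_most_one S" "\<Psi> S"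
    and S_unique: "\<And>T. involution_on R T \<Longrightarrow> fixes_at_most_one T \<Longrightarrow> \<Psi> T \<Longrightarrow> T = S"
    using mid[of R] by blast
  have SR: "Domain S = R" using S(1) unfolding involution_on_def by blast
  have S_sub: "S \<subseteq> R \<times> R"
  proof (rule subrelI)
    fix i j assume "(i, j) \<in> S"
    then show "(i, j) \<in> R \<times> R" using S(1) unfolding involution_on_def sym_def by blast
  qed
  have H: "half_diagram n M S"
  proof -
    have "Domain M \<subseteq> {1..int n}" "Range M \<subseteq> {1..int n}" using M(3,4) X Y by blast+
    then have "M \<subseteq> {1..int n} \<times> {1..int n}" by (auto simp: subset_iff Domain_iff Range_iff)
    moreover have "S \<subseteq> {1..int n} \<times> {1..int n}" using S_sub X unfolding R_def by blast
    ultimately show ?thesis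
      using M S SR unfolding half_diagram_def involution_on_def R_def by blast
  qed
  obtain P where P: "set_partition_B n P" "crossing_arcs P = full_diagram M S"
    using partition_of_half_diagram[OF H] by blast
  have eq: "pos_arcs P = M" "mid_arcs P = S"
    unfolding pos_arcs_def mid_arcs_def P(2) using half_diagram_eq[OF H] by blast+
  have "openers P = X" "closers P = Y"
    using openers_eq[OF P(1)] closers_eq[OF P(1)] eq M SR unfolding R_def by auto
  moreover from this have "\<Phi> P" using char[OF P(1)] eq M S by simp
  ultimately have ex: "set_partition_B n P \<and> \<Phi> P \<and> openers P = X \<and> closers P = Y"
    using P(1) by blast
  moreover have "Q = P"
    if Q: "set_partition_B n Q \<and> \<Phi> Q \<and> openers Q = X \<and> closers Q = Y" for Q
  proof -
    have Q': "set_partition_B n Q" using Q by blast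
    have HQ: "half_diagram n (pos_arcs Q) (mid_arcs Q)" by (rule half_diagram_of_partition[OF Q'])
    have op: "Domain (pos_arcs Q) \<union> Domain (mid_arcs Q) = X" "Range (pos_arcs Q) = Y"
      using openers_eq[OF Q'] closers_eq[OF Q'] Q by auto
    have "greedy w X (pos_arcs Q)" "\<Psi> (mid_arcs Q)" using char[OF Q'] Q by auto
    then have pos: "pos_arcs Q = M"
      using greedy_matching_unique[OF _ _ _ _ M fin(2) w] HQ op unfolding half_diagram_def by blast
    then have "Domain (mid_arcs Q) = R"
      using op HQ unfolding R_def half_diagram_def by blast
    then have "mid_arcs Q = S"
      using S_unique \<open>\<Psi> (mid_arcs Q)\<close> HQ unfolding half_diagram_def involution_on_def by blast
    then show "Q = P"
      using set_partition_B_eqI[OF Q' P(1)] crossing_arcs_eq_full_diagram[OF Q'] pos P(2) by simp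
  qed
  ultimately show ?thesis by (rule ex1I)
qed

theorem corollary4p3:
  fixes n :: nat and \<O> \<C> :: "int set"
  assumes "n \<ge> 1"
    and "opener_closer_configuration n \<O> \<C>"
  shows "(\<exists>!\<B>. set_partition_B n \<B> \<and> non_crossing \<B> \<and> openers \<B> = \<O> \<and> closers \<B> = \<C>) \<and>
         (\<exists>!\<B>'. set_partition_B n \<B>' \<and> non_nesting \<B>' \<and> openers \<B>' = \<O> \<and> closers \<B>' = \<C>)"
proof
  show "\<exists>!\<B>. set_partition_B n \<B> \<and> non_crossing \<B> \<and> openers \<B> = \<O> \<and> closers \<B> = \<C>"
    by (rule ex1_partition[OF assms(2) _ non_crossing_iff_greedy ex1_mid_noncrossing]) simp_all
  show "\<exists>!\<B>'. set_partition_B n \<B>' \<and> non_nesting \<B>' \<and> openers \<B>' = \<O> \<and> closers \<B>' = \<C>"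
    by (rule ex1_partition[OF assms(2) _ non_nesting_iff_greedy ex1_mid_nonnesting]) simp_all
qed

end
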